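(* Let $G$ be a finite group, $\Theta=\sum_iH_i-\sum_jH'_j$ a relation between permutation representations of $G$, and $\rho$ a finite-dimensional complex representation of $G$. Let $\langle,\rangle_1,\langle,\rangle_2$ be two $G$-invariant (positive definite) Hermitian inner products on $\rho$, and for each subgroup $H$ of $G$ fix a basis of $\rho^H$. Then, computing all determinants of Gram matrices with respect to these bases, $$\frac{\prod_i\det(\tfrac{1}{|H_i|}\langle,\rangle_1|\rho^{H_i})}{\prod_j\det(\tfrac{1}{|H'_j|}\langle,\rangle_1|\rho^{H'_j})}=\frac{\prod_i\det(\tfrac{1}{|H_i|}\langle,\rangle_2|\rho^{H_i})}{\prod_j\det(\tfrac{1}{|H'_j|}\langle,\rangle_2|\rho^{H'_j})}.$$
   Context: A relation between permutation representations is a formal combination $\Theta=\sum_iH_i-\sum_jH'_j$ of subgroups of $G$ with $\bigoplus_i\mathbb{C}[G/H_i]\cong\bigoplus_j\mathbb{C}[G/H'_j]$. For an inner product and a basis $\{e_k\}$ of a subspace, $\det$ denotes the determinant of the matrix $(\langle e_k,e_l\rangle)_{k,l}$. *)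

theory Defs
  imports "HOL-Algebra.Left_Coset" "HOL-Library.Function_Algebras"
    "Jordan_Normal_Form.Determinant"
begin

section \<open>Complex representations\<close>

text \<open>
  A representation lives on a subspace \<open>V\<close> of an ambient complex vector space; the values of
  \<open>act g\<close> outside \<open>V\<close>, or for \<open>g\<close> outside the carrier of \<open>G\<close>, are irrelevant.
\<close>

locale complex_rep = group G + vector_space scale
  for G (structure) and scale :: "complex \<Rightarrow> 'v::ab_group_add \<Rightarrow> 'v" +
  fixes V :: "'v set" and act :: "'g \<Rightarrow> 'v \<Rightarrow> 'v"
  assumes subspace_V: "subspace V"
    and act_closed: "\<lbrakk>g \<in> carrier G; v \<in> V\<rbrakk> \<Longrightarrow> act g v \<in> V"
    and act_add: "\<lbrakk>g \<in> carrier G; v \<in> V; w \<in> V\<rbrakk> \<Longrightarrow> act g (v + w) = act g v + act g w"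
    and act_scale: "\<lbrakk>g \<in> carrier G; v \<in> V\<rbrakk> \<Longrightarrow> act g (scale c v) = scale c (act g v)"
    and act_one: "v \<in> V \<Longrightarrow> act \<one> v = v"
    and act_mult: "\<lbrakk>g \<in> carrier G; h \<in> carrier G; v \<in> V\<rbrakk> \<Longrightarrow> act (g \<otimes> h) v = act g (act h v)"

locale fin_dim_complex_rep = complex_rep +
  assumes fin_dim: "\<exists>B. finite B \<and> span B = V"

definition rep_isomorphic ::
  "('g, 'm) monoid_scheme \<Rightarrow>
   (complex \<Rightarrow> 'v::ab_group_add \<Rightarrow> 'v) \<Rightarrow> 'v set \<Rightarrow> ('g \<Rightarrow> 'v \<Rightarrow> 'v) \<Rightarrow>
   (complex \<Rightarrow> 'w::ab_group_add \<Rightarrow> 'w) \<Rightarrow> 'w set \<Rightarrow> ('g \<Rightarrow> 'w \<Rightarrow> 'w) \<Rightarrow> bool"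
  where "rep_isomorphic G scale\<^sub>1 V\<^sub>1 act\<^sub>1 scale\<^sub>2 V\<^sub>2 act\<^sub>2 \<longleftrightarrow>
    (\<exists>f. bij_betw f V\<^sub>1 V\<^sub>2 \<and>
         (\<forall>v\<in>V\<^sub>1. \<forall>w\<in>V\<^sub>1. f (v + w) = f v + f w) \<and>
         (\<forall>c. \<forall>v\<in>V\<^sub>1. f (scale\<^sub>1 c v) = scale\<^sub>2 c (f v)) \<and>
         (\<forall>g\<in>carrier G. \<forall>v\<in>V\<^sub>1. f (act\<^sub>1 g v) = act\<^sub>2 g (f v)))"

definition fixed_space :: "'v set \<Rightarrow> ('g \<Rightarrow> 'v \<Rightarrow> 'v) \<Rightarrow> 'g set \<Rightarrow> 'v set"
  where "fixed_space V act H = {v \<in> V. \<forall>h\<in>H. act h v = v}"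

section \<open>Relations between permutation representations\<close>

text \<open>
  \<open>\<complex>[G/H]\<close> is modelled as the functions on the left cosets of \<open>H\<close> (extended by zero): \<open>f\<close> stands
  for the formal sum of the \<open>f C \<cdot> C\<close>. Hence \<open>g\<close>, which sends the basis vector \<open>C\<close> to \<open>g C\<close>, sends
  \<open>f\<close> to \<open>\<lambda>C. f (g\<^sup>-\<^sup>1 C)\<close>.
\<close>

definition perm_space :: "('g, 'm) monoid_scheme \<Rightarrow> 'g set \<Rightarrow> ('g set \<Rightarrow> complex) set"
  where "perm_space G H = {f. \<forall>C. C \<notin> lcosets\<^bsub>G\<^esub> H \<longrightarrow> f C = 0}"

definition perm_act ::
  "('g, 'm) monoid_scheme \<Rightarrow> 'g set \<Rightarrow> 'g \<Rightarrow> ('g set \<Rightarrow> complex) \<Rightarrow> ('g set \<Rightarrow> complex)"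
  where "perm_act G H g f =
    (\<lambda>C. if C \<in> lcosets\<^bsub>G\<^esub> H then f ((inv\<^bsub>G\<^esub> g) <#\<^bsub>G\<^esub> C) else 0)"

definition fun_scale :: "('c \<Rightarrow> 'v \<Rightarrow> 'v) \<Rightarrow> 'c \<Rightarrow> ('x \<Rightarrow> 'v) \<Rightarrow> ('x \<Rightarrow> 'v)"
  where "fun_scale scale c f = (\<lambda>x. scale c (f x))"

text \<open>
  The external direct sum of representations \<open>V i\<close>, \<open>i < n\<close>, that share an ambient space, with
  pointwise scalar multiplication \<^const>\<open>fun_scale\<close>.
\<close>

definition dsum_space :: "nat \<Rightarrow> (nat \<Rightarrow> 'v::zero set) \<Rightarrow> (nat \<Rightarrow> 'v) set"
  where "dsum_space n V = {F. \<forall>i. if i < n then F i \<in> V i else F i = 0}"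

definition dsum_act ::
  "nat \<Rightarrow> (nat \<Rightarrow> 'g \<Rightarrow> 'v \<Rightarrow> 'v::zero) \<Rightarrow> 'g \<Rightarrow> (nat \<Rightarrow> 'v) \<Rightarrow> (nat \<Rightarrow> 'v)"
  where "dsum_act n act g F = (\<lambda>i. if i < n then act i g (F i) else 0)"

definition dsum_perm_space ::
  "('g, 'm) monoid_scheme \<Rightarrow> 'g set list \<Rightarrow> (nat \<Rightarrow> 'g set \<Rightarrow> complex) set"
  where "dsum_perm_space G Hs = dsum_space (length Hs) (\<lambda>i. perm_space G (Hs ! i))"

definition dsum_perm_act ::
  "('g, 'm) monoid_scheme \<Rightarrow> 'g set list \<Rightarrow> 'g \<Rightarrow>
   (nat \<Rightarrow> 'g set \<Rightarrow> complex) \<Rightarrow> (nat \<Rightarrow> 'g set \<Rightarrow> complex)"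
  where "dsum_perm_act G Hs = dsum_act (length Hs) (\<lambda>i. perm_act G (Hs ! i))"

text \<open>
  The formal combination \<open>\<Theta> = \<Sum>\<^sub>i H\<^sub>i - \<Sum>\<^sub>j H'\<^sub>j\<close> is given by the two lists of its terms;
  subgroups may be repeated, and the lists may be empty or overlap.
\<close>

definition perm_relation :: "('g, 'm) monoid_scheme \<Rightarrow> 'g set list \<Rightarrow> 'g set list \<Rightarrow> bool"
  where "perm_relation G Hs Hs' \<longleftrightarrow>
    (\<forall>H \<in> set Hs \<union> set Hs'. subgroup H G) \<and>
    rep_isomorphic G
      (fun_scale (fun_scale (*))) (dsum_perm_space G Hs) (dsum_perm_act G Hs)
      (fun_scale (fun_scale (*))) (dsum_perm_space G Hs') (dsum_perm_act G Hs')"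

section \<open>Invariant inner products and Gram determinants\<close>

text \<open>
  Positive definite Hermitian inner products on \<open>V\<close>, linear in the first argument; that
  \<open>ip v v\<close> is real is part of Hermitian symmetry.
\<close>

definition hermitian_inner_product ::
  "(complex \<Rightarrow> 'v::ab_group_add \<Rightarrow> 'v) \<Rightarrow> 'v set \<Rightarrow> ('v \<Rightarrow> 'v \<Rightarrow> complex) \<Rightarrow> bool"
  where "hermitian_inner_product scale V ip \<longleftrightarrow>
    (\<forall>u\<in>V. \<forall>v\<in>V. \<forall>w\<in>V. ip (u + v) w = ip u w + ip v w) \<and>
    (\<forall>c. \<forall>v\<in>V. \<forall>w\<in>V. ip (scale c v) w = c * ip v w) \<and>
    (\<forall>v\<in>V. \<forall>w\<in>V. ip w v = cnj (ip v w)) \<and>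
    (\<forall>v\<in>V. v \<noteq> 0 \<longrightarrow> Re (ip v v) > 0)"

definition invariant_form ::
  "('g, 'm) monoid_scheme \<Rightarrow> 'v set \<Rightarrow> ('g \<Rightarrow> 'v \<Rightarrow> 'v) \<Rightarrow> ('v \<Rightarrow> 'v \<Rightarrow> complex) \<Rightarrow> bool"
  where "invariant_form G V act ip \<longleftrightarrow>
    (\<forall>g\<in>carrier G. \<forall>v\<in>V. \<forall>w\<in>V. ip (act g v) (act g w) = ip v w)"

definition (in vector_space) ordered_basis :: "'b set \<Rightarrow> 'b list \<Rightarrow> bool"
  where "ordered_basis W e \<longleftrightarrow> distinct e \<and> independent (set e) \<and> span (set e) = W"

definition gram_matrix :: "('v \<Rightarrow> 'v \<Rightarrow> complex) \<Rightarrow> 'v list \<Rightarrow> complex mat"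
  where "gram_matrix ip e = mat (length e) (length e) (\<lambda>(k, l). ip (e ! k) (e ! l))"

text \<open>\<open>det (1/|H| \<langle>,\<rangle> | \<rho>\<^sup>H)\<close>, computed in the basis \<open>e\<close> of \<open>\<rho>\<^sup>H\<close>.\<close>

definition scaled_gram_det :: "('v \<Rightarrow> 'v \<Rightarrow> complex) \<Rightarrow> 'g set \<Rightarrow> 'v list \<Rightarrow> complex"
  where "scaled_gram_det ip H e = det (gram_matrix (\<lambda>v w. 1 / of_nat (card H) * ip v w) e)"

section \<open>The constructions above are representations\<close>

lemma vector_space_fun_scale:
  assumes "vector_space scale"
  shows "vector_space (fun_scale scale)"
proof -
  interpret vector_space scale by fact
  show ?thesis
    by unfold_locales (auto simp: fun_scale_def fun_eq_iff scale_right_distrib scale_left_distrib)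
qed

lemma vector_space_mult: "vector_space ((*) :: complex \<Rightarrow> complex \<Rightarrow> complex)"
  by unfold_locales (auto simp: algebra_simps)

lemma (in group) lcosets_translate:
  assumes "subgroup H G" "g \<in> carrier G" "C \<in> lcosets H"
  shows "g <# C \<in> lcosets H"
proof -
  from assms(3) obtain a where a: "a \<in> carrier G" "C = a <# H" by (auto simp: LCOSETS_def)
  have "g <# C = (g \<otimes> a) <# H"
    using a assms subgroup.subset[OF assms(1)] by (simp add: lcos_m_assoc)
  with a assms(2) show ?thesis by (auto simp: LCOSETS_def)
qed

lemma (in group) complex_rep_perm:
  assumes H: "subgroup H G"
  shows "complex_rep G (fun_scale (*)) (perm_space G H) (perm_act G H)"
proof -
  interpret vs: vector_space "fun_scale (*) :: complex \<Rightarrow> ('a set \<Rightarrow> complex) \<Rightarrow> _"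
    by (rule vector_space_fun_scale[OF vector_space_mult])
  have sub: "C \<subseteq> carrier G" if "C \<in> lcosets H" for C
    using that subgroup.lcosets_carrier[OF H is_group] by blast
  show ?thesis
  proof unfold_locales
    show "vs.subspace (perm_space G H)"
      by (auto simp: vs.subspace_def perm_space_def fun_scale_def)
    fix v assume v: "v \<in> perm_space G H"
    show "perm_act G H \<one> v = v"
    proof
      fix C show "perm_act G H \<one> v C = v C"
        using v sub[of C] by (auto simp: perm_act_def perm_space_def lcos_mult_one)
    qed
    fix g h assume g: "g \<in> carrier G" and h: "h \<in> carrier G"
    show "perm_act G H (g \<otimes> h) v = perm_act G H g (perm_act G H h v)"
    proof
      fix C show "perm_act G H (g \<otimes> h) v C = perm_act G H g (perm_act G H h v) C"
        using g h sub[of C] lcosets_translate[OF H, of "inv g" C]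
        by (auto simp: perm_act_def inv_mult_group lcos_m_assoc)
    qed
  qed (auto simp: perm_space_def perm_act_def fun_scale_def fun_eq_iff)
qed

lemma (in group) complex_rep_dsum:
  assumes vs: "vector_space scale"
    and rep: "\<And>i. i < n \<Longrightarrow> complex_rep G scale (V i) (act i)"
  shows "complex_rep G (fun_scale scale) (dsum_space n V) (dsum_act n act)"
proof -
  interpret v: vector_space scale by fact
  interpret f: vector_space "fun_scale scale :: complex \<Rightarrow> (nat \<Rightarrow> _) \<Rightarrow> _"
    by (rule vector_space_fun_scale[OF vs])
  note r = complex_rep.act_closed[OF rep] complex_rep.act_add[OF rep]
    complex_rep.act_scale[OF rep] complex_rep.act_one[OF rep] complex_rep.act_mult[OF rep]
  have s: "v.subspace (V i)" if "i < n" for i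
    by (rule complex_rep.subspace_V[OF rep[OF that]])
  show ?thesis
  proof unfold_locales
    show "f.subspace (dsum_space n V)"
      using s by (auto simp: f.subspace_def dsum_space_def fun_scale_def v.subspace_def)
  qed (auto simp: dsum_space_def dsum_act_def fun_scale_def fun_eq_iff r)
qed

lemma (in group) complex_rep_dsum_perm:
  assumes "\<forall>H \<in> set Hs. subgroup H G"
  shows "complex_rep G (fun_scale (fun_scale (*))) (dsum_perm_space G Hs) (dsum_perm_act G Hs)"
  unfolding dsum_perm_space_def dsum_perm_act_def
  using assms by (intro complex_rep_dsum vector_space_fun_scale vector_space_mult complex_rep_perm) auto

lemma (in complex_rep) subspace_fixed_space:
  assumes "subgroup H G"
  shows "subspace (fixed_space V act H)"
proof -
  have "h \<in> carrier G" if "h \<in> H" for h using that assms by (rule subgroup.mem_carrier[rotated])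
  moreover have "act h 0 = 0" if "h \<in> carrier G" for h
    using act_scale[OF that, of 0 0] subspace_V by (simp add: subspace_def)
  ultimately show ?thesis
    using subspace_V by (auto simp: subspace_def fixed_space_def act_add act_scale)
qed

end

theory Submission
  imports Defs
begin

text \<open>
  By Riesz representation \<open>\<langle>v, w\<rangle>\<^sub>2 = \<langle>A v, w\<rangle>\<^sub>1\<close> for a \<open>G\<close>-equivariant operator \<open>A\<close> on \<open>V\<close>. On the direct
  sum of the fixed spaces of the \<open>H\<^sub>i\<close>, with the scaled forms, the second Gram determinant is
  therefore the first one times the determinant of \<open>A\<close>, and likewise for the \<open>H'\<^sub>j\<close>. These two direct
  sums are \<open>Hom\<^sub>G(\<Oplus>\<^sub>i \<complex>[G/H\<^sub>i], V)\<close> and \<open>Hom\<^sub>G(\<Oplus>\<^sub>j \<complex>[G/H'\<^sub>j], V)\<close>; precomposition with the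
  isomorphism of permutation modules identifies them and commutes with \<open>A\<close>. So both determinants of
  \<open>A\<close> agree and cancel in the quotient.
\<close>

section \<open>Gram matrices\<close>

text \<open>The identification of the two direct sums is in general no isometry and does not carry
  the chosen bases to each other, so the Gram determinants of the two sides cannot be compared one
  by one. On a single space, however, a change of basis with matrix P multiplies the Gram
  determinant of every form by |det P|^2. This factor is the same for both forms and drops out of
  the comparison. A single fixed space has no counterpart on the other side, because only the whole
  sums of permutation modules are isomorphic. This is why each product of determinants is turned
  into one determinant on an orthogonal direct sum. Both forms carry the same weight 1/|H| on a
  given summand, so the operator that relates them on the direct sum is A applied
  componentwise.\<close>

lemma det_gram_matrix_append:
  assumes "\<And>v w. v \<in> set xs \<Longrightarrow> w \<in> set ys \<Longrightarrow> ip v w = 0 \<and> ip w v = 0"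
  shows "det (gram_matrix ip (xs @ ys)) = det (gram_matrix ip xs) * det (gram_matrix ip ys)"
proof -
  let ?m = "length xs" and ?n = "length ys"
  have "gram_matrix ip (xs @ ys)
      = four_block_mat (gram_matrix ip xs) (0\<^sub>m ?m ?n) (0\<^sub>m ?n ?m) (gram_matrix ip ys)"
    by (rule eq_matI) (auto simp: gram_matrix_def nth_append assms)
  moreover have "det \<dots> = det (gram_matrix ip xs) * det (gram_matrix ip ys)"
    by (rule det_four_block_mat_lower_left_zero[where n = ?m and m = ?n])
      (auto simp: gram_matrix_def)
  ultimately show ?thesis by simp
qed

text \<open>One diagonal block is split off at a time. The hypothesis ranges over ordered pairs of
  positions, so it annihilates both off-diagonal blocks for an arbitrary function
  \<open>ip\<close>.\<close>

lemma det_gram_matrix_concat: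
  assumes "\<And>i j v w. i < length Es \<Longrightarrow> j < length Es \<Longrightarrow> i \<noteq> j \<Longrightarrow>
      v \<in> set (Es ! i) \<Longrightarrow> w \<in> set (Es ! j) \<Longrightarrow> ip v w = 0"
  shows "det (gram_matrix ip (concat Es)) = (\<Prod>es\<leftarrow>Es. det (gram_matrix ip es))"
  using assms
proof (induction Es)
  case Nil
  show ?case by (simp add: gram_matrix_def)
next
  case (Cons es Es)
  have "ip v w = 0 \<and> ip w v = 0" if v: "v \<in> set es" and w: "w \<in> set (concat Es)" for v w
  proof -
    from w obtain j where "j < length Es" "w \<in> set (Es ! j)"
      by (auto simp: in_set_conv_nth[of _ Es])
    then show ?thesis
      using Cons.prems[of 0 "Suc j" v w] Cons.prems[of "Suc j" 0 w v] v by auto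
  qed
  moreover have "det (gram_matrix ip (concat Es)) = (\<Prod>es\<leftarrow>Es. det (gram_matrix ip es))"
  proof (rule Cons.IH)
    fix i j v w
    assume "i < length Es" "j < length Es" "i \<noteq> j" "v \<in> set (Es ! i)" "w \<in> set (Es ! j)"
    then show "ip v w = 0" using Cons.prems[of "Suc i" "Suc j" v w] by simp
  qed
  ultimately show ?case by (simp add: det_gram_matrix_append del: set_concat)
qed

text \<open>Serves all the maps below that are linear on a subspace only: a form in its first
  argument, the action of a group element, the operator A, homomorphisms of permutation modules. For
  infinite \<open>I\<close> both sums are 0, and \<open>F 0 = 0\<close> follows from scaling by
  0.\<close>

lemma linear_on_sum:
  assumes s1: "vector_space s1" and s2: "vector_space s2"
    and W: "module.subspace s1 W"
    and add: "\<And>v w. v \<in> W \<Longrightarrow> w \<in> W \<Longrightarrow> F (v + w) = F v + F w"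
    and scale: "\<And>c v. v \<in> W \<Longrightarrow> F (s1 c v) = s2 c (F v)"
    and x: "\<And>k. k \<in> I \<Longrightarrow> x k \<in> W"
  shows "F (\<Sum>k\<in>I. s1 (c k) (x k)) = (\<Sum>k\<in>I. s2 (c k) (F (x k)))"
proof -
  interpret v1: vector_space s1 by fact
  interpret v2: vector_space s2 by fact
  have zero: "F 0 = 0"
    using scale[of 0 0] v1.subspace_0[OF W] by simp
  show ?thesis
    using x
  proof (induction I rule: infinite_finite_induct)
    case (insert k I)
    then have "(\<Sum>k\<in>I. s1 (c k) (x k)) \<in> W"
      by (intro v1.subspace_sum v1.subspace_scale W) auto
    then show ?case
      using insert by (simp add: add scale v1.subspace_scale[OF W])
  qed (auto simp: zero)
qed

section \<open>Coordinates with respect to lists of vectors\<close>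

locale complex_vector_space = vector_space scale
  for scale :: "complex \<Rightarrow> 'v::ab_group_add \<Rightarrow> 'v" (infixr "*s" 75)
begin

definition list_comb :: "(nat \<Rightarrow> complex) \<Rightarrow> 'v list \<Rightarrow> 'v"
  where "list_comb c es = (\<Sum>k<length es. c k *s es ! k)"

text \<open>Independence of a family indexed by positions, so that coefficients are directly matrix
  and vector entries. A repeated vector makes the list dependent.\<close>

definition list_independent :: "'v list \<Rightarrow> bool"
  where "list_independent es \<longleftrightarrow> (\<forall>c. list_comb c es = 0 \<longrightarrow> (\<forall>k<length es. c k = 0))"

lemma list_comb_in_subspace:
  assumes "subspace W" "set es \<subseteq> W"
  shows "list_comb c es \<in> W"
  unfolding list_comb_def using assms by (intro subspace_sum subspace_scale) auto

text \<open>The combinations of \<open>es\<close> form a subspace that contains every entry of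
  \<open>es\<close>, so minimality of the span supplies coordinates.\<close>

lemma span_set_eq_list_comb:
  assumes "v \<in> span (set es)"
  obtains c where "v = list_comb c es"
proof -
  have "v \<in> range (\<lambda>c. list_comb c es)"
  proof (rule span_minimal[THEN subsetD, OF _ _ assms])
    show "set es \<subseteq> range (\<lambda>c. list_comb c es)"
    proof
      fix v assume "v \<in> set es"
      then obtain k where k: "k < length es" "v = es ! k" by (auto simp: in_set_conv_nth)
      have "list_comb (\<lambda>j. if j = k then 1 else 0) es = v"
        using k by (simp add: list_comb_def if_distrib[of "\<lambda>c. c *s _"] cong: if_cong)
      then show "v \<in> range (\<lambda>c. list_comb c es)" by (metis rangeI)
    qed
    show "subspace (range (\<lambda>c. list_comb c es))"
      unfolding subspace_def
    proof (intro conjI ballI allI)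
      have "list_comb (\<lambda>_. 0) es = 0" by (simp add: list_comb_def)
      then show "0 \<in> range (\<lambda>c. list_comb c es)" by (metis rangeI)
    next
      fix x y assume "x \<in> range (\<lambda>c. list_comb c es)" "y \<in> range (\<lambda>c. list_comb c es)"
      then obtain c d where "x = list_comb c es" "y = list_comb d es" by blast
      then have "x + y = list_comb (\<lambda>k. c k + d k) es"
        by (simp add: list_comb_def scale_left_distrib sum.distrib)
      then show "x + y \<in> range (\<lambda>c. list_comb c es)" by simp
    next
      fix a x assume "x \<in> range (\<lambda>c. list_comb c es)"
      then obtain c where "x = list_comb c es" by blast
      then have "a *s x = list_comb (\<lambda>k. a * c k) es"
        by (simp add: list_comb_def scale_sum_right)
      then show "a *s x \<in> range (\<lambda>c. list_comb c es)" by simp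
    qed
  qed
  with that show ?thesis by blast
qed

lemma ordered_basis_list_independent:
  assumes "ordered_basis W es"
  shows "list_independent es"
  unfolding list_independent_def
proof (intro allI impI)
  fix c k assume c: "list_comb c es = 0" and k: "k < length es"
  \<comment> \<open>Distinctness lets coefficients of positions be read as coefficients of vectors,
    the form in which independence of a set speaks of them.\<close>
  define u where "u v = c (inv_into {..<length es} ((!) es) v)" for v
  have d: "distinct es" and ind: "independent (set es)"
    using assms by (auto simp: ordered_basis_def)
  have inj: "inj_on ((!) es) {..<length es}" using d by (auto simp: inj_on_def nth_eq_iff_index_eq)
  have im: "(!) es ` {..<length es} = set es" by (auto simp: in_set_conv_nth)
  have u: "u (es ! k) = c k" if "k < length es" for k
    using that inj by (simp add: u_def inv_into_f_f)
  have "(\<Sum>v\<in>set es. u v *s v) = list_comb c es"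
    unfolding list_comb_def im[symmetric] by (simp add: sum.reindex[OF inj] u)
  then have "u (es ! k) = 0"
    using independentD[OF ind, of "set es" u "es ! k"] c k by auto
  then show "c k = 0" using u[OF k] by simp
qed

lemma list_comb_list_comb:
  assumes "\<And>l. l < length fs \<Longrightarrow> fs ! l = list_comb (P l) es"
  shows "list_comb c fs = list_comb (\<lambda>k. \<Sum>l<length fs. c l * P l k) es"
proof -
  have "list_comb c fs = (\<Sum>l<length fs. \<Sum>k<length es. (c l * P l k) *s es ! k)"
    unfolding list_comb_def[of c fs]
    by (rule sum.cong) (auto simp: assms list_comb_def[of _ es] scale_sum_right)
  also have "\<dots> = (\<Sum>k<length es. \<Sum>l<length fs. (c l * P l k) *s es ! k)"
    by (rule sum.swap)
  finally show ?thesis by (simp add: list_comb_def scale_sum_left)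
qed

text \<open>Uniqueness of coordinates, for an entry of the list itself. It shows that base change
  there and back is the identity matrix.\<close>

lemma list_independent_unit:
  assumes "list_independent es" "k < length es" "j < length es" "es ! k = list_comb c es"
  shows "c j = (if j = k then 1 else 0)"
proof -
  have "list_comb (\<lambda>j. c j - (if j = k then 1 else 0)) es = list_comb c es - es ! k"
    using assms(2) by (simp add: list_comb_def scale_left_diff_distrib sum_subtractf
        if_distrib[of "\<lambda>c. c *s _"] cong: if_cong)
  then show ?thesis using assms by (auto simp: list_independent_def)
qed

text \<open>The two products of the base change matrices are identities; compare their traces.\<close>

lemma list_independent_length_eq:
  assumes es: "list_independent es" and fs: "list_independent fs"
    and P: "\<And>l. l < length fs \<Longrightarrow> fs ! l = list_comb (P l) es"
    and Q: "\<And>k. k < length es \<Longrightarrow> es ! k = list_comb (Q k) fs"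
  shows "length es = length fs"
proof -
  have 1: "(\<Sum>l<length fs. Q k l * P l k) = 1" if k: "k < length es" for k
    using list_independent_unit[OF es k k, of "\<lambda>j. \<Sum>l<length fs. Q k l * P l j"]
      Q[OF k] list_comb_list_comb[of fs P es "Q k", OF P] by simp
  have 2: "(\<Sum>k<length es. P l k * Q k l) = 1" if l: "l < length fs" for l
    using list_independent_unit[OF fs l l, of "\<lambda>j. \<Sum>k<length es. P l k * Q k j"]
      P[OF l] list_comb_list_comb[of es Q fs "P l", OF Q] by simp
  have "(of_nat (length es) :: complex) = (\<Sum>k<length es. \<Sum>l<length fs. Q k l * P l k)" by (simp add: 1)
  also have "\<dots> = (\<Sum>l<length fs. \<Sum>k<length es. P l k * Q k l)"
    by (subst sum.swap) (simp add: mult.commute)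
  also have "\<dots> = of_nat (length fs)" by (simp add: 2)
  finally show ?thesis by (simp only: of_nat_eq_iff)
qed

end

section \<open>Gram determinants and Riesz representation for a form on a subspace\<close>

locale hermitian_space = complex_vector_space scale
  for scale :: "complex \<Rightarrow> 'v::ab_group_add \<Rightarrow> 'v" +
  fixes W :: "'v set" and ip :: "'v \<Rightarrow> 'v \<Rightarrow> complex"
  assumes subspace_W: "subspace W"
    and hermitian: "hermitian_inner_product scale W ip"
begin

lemma ip_add: "\<lbrakk>u \<in> W; v \<in> W; w \<in> W\<rbrakk> \<Longrightarrow> ip (u + v) w = ip u w + ip v w"
  and ip_scale: "\<lbrakk>v \<in> W; w \<in> W\<rbrakk> \<Longrightarrow> ip (scale c v) w = c * ip v w"
  and ip_cnj: "\<lbrakk>v \<in> W; w \<in> W\<rbrakk> \<Longrightarrow> ip w v = cnj (ip v w)"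
  and ip_pos: "\<lbrakk>v \<in> W; v \<noteq> 0\<rbrakk> \<Longrightarrow> Re (ip v v) > 0"
  using hermitian unfolding hermitian_inner_product_def by blast+

lemma ip_zero: "w \<in> W \<Longrightarrow> ip 0 w = 0"
  using ip_scale[of 0 w 0] subspace_0[OF subspace_W] by simp

lemma ip_sum:
  assumes "\<And>k. k \<in> I \<Longrightarrow> x k \<in> W" "w \<in> W"
  shows "ip (\<Sum>k\<in>I. scale (c k) (x k)) w = (\<Sum>k\<in>I. c k * ip (x k) w)"
  by (rule linear_on_sum[OF vector_space_axioms vector_space_mult subspace_W, where F = "\<lambda>v. ip v w"])
    (use assms in \<open>simp_all add: ip_add ip_scale\<close>)

lemma ip_list_comb_left:
  assumes "set es \<subseteq> W" "w \<in> W"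
  shows "ip (list_comb c es) w = (\<Sum>k<length es. c k * ip (es ! k) w)"
  unfolding list_comb_def using assms by (intro ip_sum) auto

lemma ip_list_comb_right:
  assumes es: "set es \<subseteq> W" and w: "w \<in> W"
  shows "ip w (list_comb c es) = (\<Sum>k<length es. cnj (c k) * ip w (es ! k))"
proof -
  have "ip w (list_comb c es) = cnj (ip (list_comb c es) w)"
    using w list_comb_in_subspace[OF subspace_W es] by (rule ip_cnj[rotated])
  also have "\<dots> = (\<Sum>k<length es. cnj (c k) * cnj (ip (es ! k) w))"
    by (simp add: ip_list_comb_left[OF es w])
  also have "\<dots> = (\<Sum>k<length es. cnj (c k) * ip w (es ! k))"
    by (rule sum.cong[OF refl]) (use es w in \<open>simp add: ip_cnj[of "es ! _" w] subset_iff\<close>)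
  finally show ?thesis .
qed

text \<open>Testing with \<open>w = u - v\<close> and using positivity. This uniqueness of the
  representing vector later yields all the laws of A.\<close>

lemma ip_eqI:
  assumes "u \<in> W" "v \<in> W" "\<And>w. w \<in> W \<Longrightarrow> ip u w = ip v w"
  shows "u = v"
proof (rule ccontr)
  assume "u \<noteq> v"
  have d: "u - v \<in> W" using assms subspace_W by (simp add: subspace_diff)
  \<comment> \<open>The axioms of the form speak of sums and multiples only, so the difference is
    first written as a sum.\<close>
  have "ip (u + scale (-1) v) w = ip u w + -1 * ip v w" if "w \<in> W" for w
    using assms that subspace_W by (simp only: ip_add ip_scale subspace_scale)
  from this[OF d] have "ip (u - v) (u - v) = ip u (u - v) - ip v (u - v)" by simp
  with assms(3)[OF d] ip_pos[OF d] \<open>u \<noteq> v\<close> show False by simp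
qed

lemma gram_matrix_carrier [simp]: "gram_matrix ip es \<in> carrier_mat (length es) (length es)"
  by (simp add: gram_matrix_def)

text \<open>A kernel vector \<open>v\<close> of the transposed Gram matrix gives a combination
  \<open>x\<close> of \<open>es\<close> that is orthogonal to every entry of \<open>es\<close>,
  hence to itself, so \<open>x = 0\<close>. The transpose appears because the coefficients of
  \<open>x\<close> sit in the first argument of \<open>ip\<close>.\<close>

lemma det_gram_matrix_nonzero:
  assumes es: "set es \<subseteq> W" and ind: "list_independent es"
  shows "det (gram_matrix ip es) \<noteq> 0"
proof
  let ?n = "length es"
  assume "det (gram_matrix ip es) = 0"
  then have "det (transpose_mat (gram_matrix ip es)) = 0"
    by (subst det_transpose[of _ ?n]) auto
  then obtain v where v: "v \<in> carrier_vec ?n" "v \<noteq> 0\<^sub>v ?n"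
      "transpose_mat (gram_matrix ip es) *\<^sub>v v = 0\<^sub>v ?n"
    using det_0_iff_vec_prod_zero[of "transpose_mat (gram_matrix ip es)" ?n] by auto
  define x where "x = list_comb (($) v) es"
  have x: "x \<in> W" unfolding x_def by (rule list_comb_in_subspace[OF subspace_W es])
  have "ip x (es ! l) = 0" if l: "l < ?n" for l
  proof -
    have "ip x (es ! l) = (\<Sum>k<?n. v $ k * ip (es ! k) (es ! l))"
      unfolding x_def using es l by (intro ip_list_comb_left) auto
    also have "\<dots> = (transpose_mat (gram_matrix ip es) *\<^sub>v v) $ l"
      using l v(1) by (simp add: gram_matrix_def scalar_prod_def mult.commute lessThan_atLeast0)
    finally show ?thesis using v l by simp
  qed
  then have "ip x x = 0"
    using ip_list_comb_right[OF es x, of "($) v"] by (simp add: x_def)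
  then have "x = 0" using ip_pos[OF x] by auto
  then have "v $ k = 0" if "k < ?n" for k
    using ind that by (simp add: x_def list_independent_def)
  then have "v = 0\<^sub>v ?n" using v(1) by (intro eq_vecI) auto
  with v(2) show False ..
qed

text \<open>A linear relation among the entries is a kernel vector of the transposed Gram matrix.
  This is how the basis of a direct sum will be seen to be independent, as its Gram determinant is a
  product of known nonzero factors.\<close>

lemma list_independent_if_det_gram_matrix:
  assumes es: "set es \<subseteq> W" and det: "det (gram_matrix ip es) \<noteq> 0"
  shows "list_independent es"
  unfolding list_independent_def
proof (intro allI impI)
  let ?n = "length es"
  fix c k assume c: "list_comb c es = 0" and k: "k < ?n"
  have "transpose_mat (gram_matrix ip es) *\<^sub>v vec ?n c = 0\<^sub>v ?n"
  proof (rule eq_vecI)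
    fix l assume "l < dim_vec (0\<^sub>v ?n :: complex vec)"
    then have l: "l < ?n" by simp
    then have "(\<Sum>k<?n. c k * ip (es ! k) (es ! l)) = ip (list_comb c es) (es ! l)"
      using es by (subst ip_list_comb_left) auto
    also have "\<dots> = 0" using c l es by (simp add: ip_zero subset_iff)
    finally show "(transpose_mat (gram_matrix ip es) *\<^sub>v vec ?n c) $ l = 0\<^sub>v ?n $ l"
      using l by (simp add: gram_matrix_def scalar_prod_def mult.commute lessThan_atLeast0)
  qed (simp add: gram_matrix_def)
  moreover have "det (transpose_mat (gram_matrix ip es)) \<noteq> 0"
    using det by (subst det_transpose[of _ ?n]) auto
  ultimately have "vec ?n c = 0\<^sub>v ?n"
    using det_0_iff_vec_prod_zero[of "transpose_mat (gram_matrix ip es)" ?n] vec_carrier[of ?n c]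
    by (metis gram_matrix_carrier transpose_carrier_mat)
  then show "c k = 0" using k by (metis index_vec index_zero_vec(1))
qed

text \<open>The Gram matrix becomes P G P* with P* the conjugate transpose of P. The point is that
  the outer factors do not involve \<open>ip\<close>, so two forms on the same space share
  them.\<close>

lemma gram_matrix_change_basis:
  assumes es: "set es \<subseteq> W" and len: "length fs = length es"
    and P: "\<And>l. l < length fs \<Longrightarrow> fs ! l = list_comb (P l) es"
  shows "det (gram_matrix ip fs) =
    det (mat (length es) (length es) (\<lambda>(l, k). P l k)) * det (gram_matrix ip es) *
    det (mat (length es) (length es) (\<lambda>(k, l). cnj (P l k)))"
proof -
  let ?n = "length es"
  let ?P = "mat ?n ?n (\<lambda>(l, k). P l k)" and ?P' = "mat ?n ?n (\<lambda>(k, l). cnj (P l k))"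
  have "gram_matrix ip fs = ?P * gram_matrix ip es * ?P'"
  proof (rule eq_matI)
    fix i j assume "i < dim_row (?P * gram_matrix ip es * ?P')"
      and "j < dim_col (?P * gram_matrix ip es * ?P')"
    then have ij: "i < ?n" "j < ?n" by auto
    have W: "list_comb (P j) es \<in> W" by (rule list_comb_in_subspace[OF subspace_W es])
    have "gram_matrix ip fs $$ (i, j) = ip (list_comb (P i) es) (list_comb (P j) es)"
      using ij len by (simp add: gram_matrix_def P)
    also have "\<dots> = (\<Sum>k<?n. cnj (P j k) * ip (list_comb (P i) es) (es ! k))"
      by (intro ip_list_comb_right es list_comb_in_subspace subspace_W)
    also have "\<dots> = (\<Sum>k<?n. cnj (P j k) * (\<Sum>l<?n. P i l * ip (es ! l) (es ! k)))"
      by (rule sum.cong[OF refl], subst ip_list_comb_left) (use es in auto)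
    also have "\<dots> = (?P * gram_matrix ip es * ?P') $$ (i, j)"
      using ij by (simp add: gram_matrix_def scalar_prod_def mult.commute lessThan_atLeast0)
    finally show "gram_matrix ip fs $$ (i, j) = (?P * gram_matrix ip es * ?P') $$ (i, j)" .
  qed (auto simp: gram_matrix_def len)
  moreover have PG: "?P * gram_matrix ip es \<in> carrier_mat ?n ?n"
    by (rule mult_carrier_mat[of _ _ ?n]) auto
  ultimately show ?thesis by (simp add: det_mult[OF PG] det_mult[of _ ?n])
qed

text \<open>Linearity in the first argument makes A a left factor: G' = M G, where row k of M holds
  the coordinates of \<open>A (es ! k)\<close>. So det M is the determinant of A.\<close>

lemma det_gram_matrix_operator:
  assumes es: "set es \<subseteq> W"
    and ip': "\<And>v w. v \<in> set es \<Longrightarrow> w \<in> set es \<Longrightarrow> ip' v w = ip (A v) w"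
    and M: "\<And>k. k < length es \<Longrightarrow> A (es ! k) = list_comb (M k) es"
  shows "det (gram_matrix ip' es) =
    det (mat (length es) (length es) (\<lambda>(k, l). M k l)) * det (gram_matrix ip es)"
proof -
  let ?n = "length es"
  let ?M = "mat ?n ?n (\<lambda>(k, l). M k l)"
  have "gram_matrix ip' es = ?M * gram_matrix ip es"
  proof (rule eq_matI)
    fix i j assume "i < dim_row (?M * gram_matrix ip es)" "j < dim_col (?M * gram_matrix ip es)"
    then have ij: "i < ?n" "j < ?n" by (auto simp: gram_matrix_def)
    then have "gram_matrix ip' es $$ (i, j) = ip (list_comb (M i) es) (es ! j)"
      by (simp add: gram_matrix_def ip' M)
    also have "\<dots> = (\<Sum>k<?n. M i k * ip (es ! k) (es ! j))"
      using es ij by (intro ip_list_comb_left) auto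
    also have "\<dots> = (?M * gram_matrix ip es) $$ (i, j)"
      using ij by (simp add: gram_matrix_def scalar_prod_def lessThan_atLeast0)
    finally show "gram_matrix ip' es $$ (i, j) = (?M * gram_matrix ip es) $$ (i, j)" .
  qed (auto simp: gram_matrix_def)
  then show ?thesis using det_mult[of ?M ?n "gram_matrix ip es"] by simp
qed

text \<open>The coordinates of \<open>u\<close> solve a linear system with the transposed Gram
  matrix, which is invertible by positivity. Agreement on \<open>es\<close> extends to
  \<open>W\<close> because both forms are conjugate-linear in the second argument.\<close>

lemma riesz_representation:
  assumes es: "set es \<subseteq> W" "W \<subseteq> span (set es)" and ind: "list_independent es"
    and ip': "hermitian_inner_product scale W ip'" and v: "v \<in> W"
  obtains u where "u \<in> W" "\<And>w. w \<in> W \<Longrightarrow> ip u w = ip' v w"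
proof -
  interpret H: hermitian_space scale W ip' by unfold_locales (rule subspace_W, rule ip')
  let ?n = "length es"
  define y where "y = vec ?n (\<lambda>l. ip' v (es ! l))"
  let ?G = "transpose_mat (gram_matrix ip es)"
  have "det ?G \<noteq> 0"
    using det_gram_matrix_nonzero[OF es(1) ind] by (subst det_transpose[of _ ?n]) auto
  then obtain B where B: "B \<in> carrier_mat ?n ?n" "?G * B = 1\<^sub>m ?n"
    using det_non_zero_imp_unit[of ?G ?n] by (auto simp: Units_def ring_mat_simps)
  define x where "x = B *\<^sub>v y"
  define u where "u = list_comb (($) x) es"
  have y: "y \<in> carrier_vec ?n" by (simp add: y_def)
  have "?G *\<^sub>v x = y"
    unfolding x_def using assoc_mult_mat_vec[of ?G ?n ?n B ?n y] B y by simp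
  have u: "u \<in> W" unfolding u_def by (rule list_comb_in_subspace[OF subspace_W es(1)])
  have basis: "ip u (es ! l) = ip' v (es ! l)" if l: "l < ?n" for l
  proof -
    have "ip u (es ! l) = (\<Sum>k<?n. x $ k * ip (es ! k) (es ! l))"
      unfolding u_def using es l by (intro ip_list_comb_left) auto
    also have "\<dots> = (?G *\<^sub>v x) $ l"
      using l B(1) y by (simp add: x_def gram_matrix_def scalar_prod_def mult.commute lessThan_atLeast0)
    finally show ?thesis using \<open>?G *\<^sub>v x = y\<close> l by (simp add: y_def)
  qed
  have "ip u w = ip' v w" if w: "w \<in> W" for w
  proof -
    from w es(2) obtain c where "w = list_comb c es" by (blast elim: span_set_eq_list_comb)
    then show ?thesis
      using ip_list_comb_right[OF es(1) u] H.ip_list_comb_right[OF es(1) v] basis by simp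
  qed
  with u that show ?thesis by blast
qed

end

text \<open>The linear algebra of the whole argument. \<open>T\<close> carries \<open>es\<close> to
  a basis \<open>ts\<close> of \<open>W'\<close>, and by \<open>TA\<close> the matrix M of
  \<open>A\<close> in \<open>es\<close> is also that of \<open>B\<close> in \<open>ts\<close>. Hence
  passing to the second form multiplies the determinants for \<open>es\<close> and \<open>ts\<close>
  by the same det M, and replacing \<open>ts\<close> by \<open>fs\<close> costs a factor common to
  both forms.\<close>

lemma (in complex_vector_space) gram_det_ratio_eq:
  assumes W: "subspace W" and W': "subspace W'"
    and p: "hermitian_inner_product scale W p\<^sub>1" "hermitian_inner_product scale W p\<^sub>2"
    and q: "hermitian_inner_product scale W' q\<^sub>1" "hermitian_inner_product scale W' q\<^sub>2"
    and es: "set es \<subseteq> W" "W \<subseteq> span (set es)" "list_independent es"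
    and fs: "set fs \<subseteq> W'" "W' \<subseteq> span (set fs)" "list_independent fs"
    and T: "bij_betw T W W'"
    and T_add: "\<And>v w. v \<in> W \<Longrightarrow> w \<in> W \<Longrightarrow> T (v + w) = T v + T w"
    and T_scale: "\<And>c v. v \<in> W \<Longrightarrow> T (c *s v) = c *s T v"
    and A: "\<And>v. v \<in> W \<Longrightarrow> A v \<in> W"
    and pA: "\<And>v w. v \<in> W \<Longrightarrow> w \<in> W \<Longrightarrow> p\<^sub>2 v w = p\<^sub>1 (A v) w"
    and qB: "\<And>v w. v \<in> W' \<Longrightarrow> w \<in> W' \<Longrightarrow> q\<^sub>2 v w = q\<^sub>1 (B v) w"
    and TA: "\<And>v. v \<in> W \<Longrightarrow> T (A v) = B (T v)"
  shows "det (gram_matrix p\<^sub>1 es) / det (gram_matrix q\<^sub>1 fs)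
       = det (gram_matrix p\<^sub>2 es) / det (gram_matrix q\<^sub>2 fs)"
proof -
  interpret p1: hermitian_space scale W p\<^sub>1 by unfold_locales (rule W, rule p)
  interpret p2: hermitian_space scale W p\<^sub>2 by unfold_locales (rule W, rule p)
  interpret q1: hermitian_space scale W' q\<^sub>1 by unfold_locales (rule W', rule q)
  interpret q2: hermitian_space scale W' q\<^sub>2 by unfold_locales (rule W', rule q)
  define ts where "ts = map T es"
  have len: "length ts = length es" by (simp add: ts_def)
  have TW: "T v \<in> W'" if "v \<in> W" for v using T that by (auto simp: bij_betw_def)
  have ts_W: "set ts \<subseteq> W'" using es(1) TW by (auto simp: ts_def)
  have T_comb: "T (list_comb c es) = list_comb c ts" for c
  proof -
    have "T (list_comb c es) = (\<Sum>k<length es. c k *s T (es ! k))"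
      unfolding list_comb_def
      by (rule linear_on_sum[OF vector_space_axioms vector_space_axioms W])
        (use es(1) in \<open>auto simp: T_add T_scale\<close>)
    then show ?thesis by (simp add: list_comb_def ts_def)
  qed
  have "list_independent ts"
    unfolding list_independent_def
  proof (rule allI, rule impI)
    fix c assume "list_comb c ts = 0"
    moreover have "T 0 = 0" using T_scale[of 0 0] subspace_0[OF W] by simp
    ultimately have "T (list_comb c es) = T 0" by (simp add: T_comb)
    then have "list_comb c es = 0"
      using T subspace_0[OF W] list_comb_in_subspace[OF W es(1)]
      by (auto simp: bij_betw_def dest: inj_onD)
    then show "\<forall>k<length ts. c k = 0" using es(3) by (simp add: list_independent_def len)
  qed
  have comb_ts: "\<exists>c. w = list_comb c ts" if w: "w \<in> W'" for w
  proof -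
    from w T obtain v where "v \<in> W" "w = T v" by (auto simp: bij_betw_def)
    moreover from \<open>v \<in> W\<close> es(2) obtain c where "v = list_comb c es"
      by (blast elim: span_set_eq_list_comb)
    ultimately show ?thesis using T_comb by blast
  qed
  have "\<forall>l. \<exists>c. l < length fs \<longrightarrow> fs ! l = list_comb c ts"
    using comb_ts fs(1) nth_mem by blast
  then obtain P where P: "\<And>l. l < length fs \<Longrightarrow> fs ! l = list_comb (P l) ts"
    by metis
  have "\<forall>k. \<exists>c. k < length ts \<longrightarrow> ts ! k = list_comb c fs"
    using ts_W fs(2) nth_mem by (blast elim: span_set_eq_list_comb)
  then obtain Q where Q: "\<And>k. k < length ts \<Longrightarrow> ts ! k = list_comb (Q k) fs"
    by metis
  \<comment> \<open>Both lists are bases of \<open>W'\<close>; equal length makes the base change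
    matrix square.\<close>
  have len': "length fs = length ts"
    using list_independent_length_eq[OF \<open>list_independent ts\<close> fs(3), of P Q] P Q by simp
  have "\<forall>k. \<exists>c. k < length es \<longrightarrow> A (es ! k) = list_comb c es"
    using A es(1,2) nth_mem by (blast elim: span_set_eq_list_comb)
  then obtain M where M: "\<And>k. k < length es \<Longrightarrow> A (es ! k) = list_comb (M k) es"
    by metis
  have BM: "B (ts ! k) = list_comb (M k) ts" if "k < length ts" for k
    using that M[of k] TA[of "es ! k"] T_comb es(1) by (simp add: ts_def subset_iff)
  have p21: "det (gram_matrix p\<^sub>2 es) =
      det (mat (length es) (length es) (\<lambda>(k, l). M k l)) * det (gram_matrix p\<^sub>1 es)"
    by (rule p1.det_gram_matrix_operator[where A = A]) (use es(1) pA M in \<open>simp_all add: subset_iff\<close>)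
  have q21: "det (gram_matrix q\<^sub>2 ts) =
      det (mat (length es) (length es) (\<lambda>(k, l). M k l)) * det (gram_matrix q\<^sub>1 ts)"
    unfolding len[symmetric]
    by (rule q1.det_gram_matrix_operator[where A = B]) (use ts_W qB BM in \<open>simp_all add: subset_iff\<close>)
  \<comment> \<open>This factor has to cancel between numerator and denominator of the second
    quotient. The base change factors stand in both denominators alike.\<close>
  have "det (mat (length es) (length es) (\<lambda>(k, l). M k l)) \<noteq> 0"
    using p2.det_gram_matrix_nonzero[OF es(1,3)] p21 by auto
  then show ?thesis
    using q1.gram_matrix_change_basis[OF ts_W len' P] q2.gram_matrix_change_basis[OF ts_W len' P]
    by (simp add: p21 q21)
qed

section \<open>Orthogonal direct sums with weighted forms\<close>

definition dsum_form ::
  "nat \<Rightarrow> (nat \<Rightarrow> nat) \<Rightarrow> ('v \<Rightarrow> 'v \<Rightarrow> complex) \<Rightarrow> (nat \<Rightarrow> 'v) \<Rightarrow> (nat \<Rightarrow> 'v) \<Rightarrow> complex"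
  where "dsum_form n m ip x y = (\<Sum>i<n. 1 / of_nat (m i) * ip (x i) (y i))"

definition dsum_incl :: "nat \<Rightarrow> 'v::zero \<Rightarrow> nat \<Rightarrow> 'v"
  where "dsum_incl i v = (\<lambda>j. if j = i then v else 0)"

definition dsum_basis :: "nat \<Rightarrow> (nat \<Rightarrow> 'v::zero list) \<Rightarrow> (nat \<Rightarrow> 'v) list"
  where "dsum_basis n e = concat (map (\<lambda>i. map (dsum_incl i) (e i)) [0..<n])"

lemma (in complex_vector_space) complex_vector_space_fun_scale:
  "complex_vector_space (fun_scale scale)"
  by (simp add: complex_vector_space_def vector_space_fun_scale vector_space_axioms)

lemma (in complex_vector_space) subspace_dsum_space:
  assumes "\<And>i. i < n \<Longrightarrow> subspace (U i)"
  shows "module.subspace (fun_scale scale) (dsum_space n U)"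
proof -
  interpret f: complex_vector_space "fun_scale scale :: complex \<Rightarrow> (nat \<Rightarrow> 'v) \<Rightarrow> _"
    by (rule complex_vector_space_fun_scale)
  show ?thesis
    using assms by (auto simp: f.subspace_def dsum_space_def fun_scale_def subspace_def)
qed

lemma (in complex_vector_space) dsum_space_subset_span:
  assumes e: "\<And>i. i < n \<Longrightarrow> U i \<subseteq> span (set (e i))"
  shows "dsum_space n U \<subseteq> module.span (fun_scale scale) (set (dsum_basis n e))"
proof
  interpret f: complex_vector_space "fun_scale scale :: complex \<Rightarrow> (nat \<Rightarrow> 'v) \<Rightarrow> _"
    by (rule complex_vector_space_fun_scale)
  let ?S = "f.span (set (dsum_basis n e))"
  have incl: "dsum_incl i v \<in> ?S" if i: "i < n" and v: "v \<in> span (set (e i))" for i v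
  proof -
    \<comment> \<open>The inclusion of a summand is linear, so the preimage of \<open>?S\<close> is
      a subspace.\<close>
    have "span (set (e i)) \<subseteq> {v. dsum_incl i v \<in> ?S}"
    proof (rule span_minimal)
      show "set (e i) \<subseteq> {v. dsum_incl i v \<in> ?S}"
        using i by (auto intro!: f.span_base simp: dsum_basis_def)
      have "dsum_incl i 0 = (0 :: nat \<Rightarrow> 'v)"
        and "dsum_incl i (v + w) = dsum_incl i v + dsum_incl i w"
        and "dsum_incl i (c *s v) = fun_scale scale c (dsum_incl i v)" for v w :: 'v and c
        by (auto simp: dsum_incl_def fun_eq_iff fun_scale_def)
      then show "subspace {v. dsum_incl i v \<in> ?S}"
        by (auto simp: subspace_def f.span_zero f.span_add f.span_scale)
    qed
    with v show ?thesis by blast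
  qed
  fix x assume x: "x \<in> dsum_space n U"
  have "x = (\<Sum>i<n. dsum_incl i (x i))"
  proof
    fix j
    have "(\<Sum>i<n. dsum_incl i (x i)) j = (\<Sum>i<n. dsum_incl i (x i) j)"
      by (induction n) auto
    also have "\<dots> = x j" using x by (auto simp: dsum_incl_def dsum_space_def)
    finally show "x j = (\<Sum>i<n. dsum_incl i (x i)) j" by simp
  qed
  also have "\<dots> \<in> ?S"
    using x e by (intro f.span_sum incl) (force simp: dsum_space_def)+
  finally show "x \<in> ?S" .
qed

context hermitian_space
begin

lemma dsum_hermitian_inner_product:
  assumes U: "\<And>i. i < n \<Longrightarrow> subspace (U i)" "\<And>i. i < n \<Longrightarrow> U i \<subseteq> W"
    and m: "\<And>i. i < n \<Longrightarrow> m i > 0"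
  shows "hermitian_inner_product (fun_scale scale) (dsum_space n U) (dsum_form n m ip)"
proof -
  have W: "x i \<in> W" if "x \<in> dsum_space n U" "i < n" for x i
    using that U(2) by (force simp: dsum_space_def)
  have "Re (dsum_form n m ip x x) > 0" if x: "x \<in> dsum_space n U" "x \<noteq> 0" for x
  proof -
    from x obtain i where i: "i < n" "x i \<noteq> 0"
      unfolding dsum_space_def fun_eq_iff by (auto split: if_splits)
    have "Re (dsum_form n m ip x x) = (\<Sum>i<n. Re (ip (x i) (x i)) / real (m i))"
      by (simp add: dsum_form_def Re_divide_of_nat)
    also have "\<dots> > 0"
    proof (rule sum_pos2[of _ i])
      show "0 < Re (ip (x i) (x i)) / real (m i)"
        using i m W[OF x(1)] by (simp add: ip_pos)
      show "0 \<le> Re (ip (x j) (x j)) / real (m j)" if "j \<in> {..<n}" for j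
        using that W[OF x(1), of j] ip_pos[of "x j"] ip_zero[of "x j"]
        by (cases "x j = 0") (auto intro: less_imp_le)
    qed (use i in auto)
    finally show ?thesis .
  qed
  moreover have "dsum_form n m ip y x = cnj (dsum_form n m ip x y)"
    if "x \<in> dsum_space n U" "y \<in> dsum_space n U" for x y
    using ip_cnj[OF W[OF that(1)] W[OF that(2)]] by (simp add: dsum_form_def)
  moreover have "dsum_form n m ip (u + v) w = dsum_form n m ip u w + dsum_form n m ip v w"
    if "u \<in> dsum_space n U" "v \<in> dsum_space n U" "w \<in> dsum_space n U" for u v w
    unfolding dsum_form_def sum.distrib[symmetric]
    by (rule sum.cong) (simp_all add: ip_add W that add_divide_distrib)
  moreover have "dsum_form n m ip (fun_scale scale c v) w = c * dsum_form n m ip v w"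
    if "v \<in> dsum_space n U" "w \<in> dsum_space n U" for c v w
    unfolding dsum_form_def sum_distrib_left
    by (rule sum.cong) (simp_all add: fun_scale_def ip_scale W that)
  ultimately show ?thesis unfolding hermitian_inner_product_def by blast
qed

lemma scaled_hermitian_inner_product:
  assumes "m > 0"
  shows "hermitian_inner_product scale W (\<lambda>v w. 1 / of_nat m * ip v w)"
  unfolding hermitian_inner_product_def
proof (intro conjI ballI allI impI)
  fix v w assume "v \<in> W" "w \<in> W"
  then show "1 / of_nat m * ip w v = cnj (1 / of_nat m * ip v w)"
    using ip_cnj[of v w] by simp
next
  fix v assume "v \<in> W" "v \<noteq> 0"
  then show "Re (1 / of_nat m * ip v v) > 0"
    using ip_pos[of v] assms by (simp add: Re_divide_of_nat)
qed (simp_all add: ip_add ip_scale add_divide_distrib)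

lemma scaled_gram_det_nonzero:
  assumes "set es \<subseteq> W" "list_independent es" "card H > 0"
  shows "scaled_gram_det ip H es \<noteq> 0"
proof -
  interpret s: hermitian_space scale W "\<lambda>v w. 1 / of_nat (card H) * ip v w"
    by unfold_locales (rule subspace_W, rule scaled_hermitian_inner_product[OF assms(3)])
  show ?thesis
    unfolding scaled_gram_det_def by (rule s.det_gram_matrix_nonzero[OF assms(1,2)])
qed

text \<open>Distinct summands are orthogonal, and on the i-th one the form is \<open>ip\<close>
  scaled by 1/(m i). With \<open>m i\<close> the order of the i-th subgroup, the diagonal blocks are
  exactly those of \<open>scaled_gram_det\<close>.\<close>

lemma det_gram_matrix_dsum_basis:
  assumes e: "\<And>i. i < n \<Longrightarrow> set (e i) \<subseteq> W"
  shows "det (gram_matrix (dsum_form n m ip) (dsum_basis n e))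
    = (\<Prod>i\<leftarrow>[0..<n]. det (gram_matrix (\<lambda>v w. 1 / of_nat (m i) * ip v w) (e i)))"
proof -
  have 0: "0 \<in> W" by (rule subspace_0[OF subspace_W])
  have ip0: "ip w 0 = 0" if "w \<in> W" for w using ip_cnj[OF 0 that] ip_zero[OF that] by simp
  have form: "dsum_form n m ip (dsum_incl i v) (dsum_incl j w)
      = (if i = j then 1 / of_nat (m i) * ip v w else 0)"
    if "i < n" "j < n" "v \<in> W" "w \<in> W" for i j v w
  proof -
    have "dsum_form n m ip (dsum_incl i v) (dsum_incl j w)
        = (\<Sum>k<n. if k = i then if i = j then 1 / of_nat (m i) * ip v w else 0 else 0)"
      unfolding dsum_form_def dsum_incl_def
      by (rule sum.cong) (use that 0 in \<open>auto simp: ip_zero ip0\<close>)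
    also have "\<dots> = (if i = j then 1 / of_nat (m i) * ip v w else 0)"
      using that by simp
    finally show ?thesis .
  qed
  have "det (gram_matrix (dsum_form n m ip) (dsum_basis n e))
      = (\<Prod>es\<leftarrow>map (\<lambda>i. map (dsum_incl i) (e i)) [0..<n]. det (gram_matrix (dsum_form n m ip) es))"
    unfolding dsum_basis_def
  proof (rule det_gram_matrix_concat)
    fix i j v w
    assume "i < length (map (\<lambda>i. map (dsum_incl i) (e i)) [0..<n])"
      and "j < length (map (\<lambda>i. map (dsum_incl i) (e i)) [0..<n])" and "i \<noteq> j"
      and "v \<in> set (map (\<lambda>i. map (dsum_incl i) (e i)) [0..<n] ! i)"
      and "w \<in> set (map (\<lambda>i. map (dsum_incl i) (e i)) [0..<n] ! j)"
    then show "dsum_form n m ip v w = 0" using e by (auto simp: form subset_iff)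
  qed
  moreover have "gram_matrix (dsum_form n m ip) (map (dsum_incl i) (e i))
      = gram_matrix (\<lambda>v w. 1 / of_nat (m i) * ip v w) (e i)" if "i < n" for i
    using e[OF that] that by (intro eq_matI) (auto simp: gram_matrix_def form subset_iff)
  ultimately show ?thesis
    by (auto intro!: arg_cong[of _ _ prod_list] map_cong simp del: times_divide_eq_left)
qed

end

section \<open>Homomorphisms from permutation modules\<close>

lemma (in group) l_coset_eq_self_iff:
  assumes "subgroup H G" "g \<in> carrier G"
  shows "g <# H = H \<longleftrightarrow> g \<in> H"
  using assms lcos_self[of g H] coset_join3[of g H] subgroup.subset[of H G] by auto

text \<open>The representatives of a left coset are its elements, so a sum over the group meets each
  coset of H exactly |H| times. Division by the order of the subgroup in the formulas below undoes
  this.\<close>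

lemma (in group) l_coset_fibre:
  assumes H: "subgroup H G" and C: "C \<in> lcosets H"
  shows "{g \<in> carrier G. g <# H = C} = C"
proof -
  from C obtain a where a: "a \<in> carrier G" "C = a <# H" by (auto simp: LCOSETS_def)
  then show ?thesis
    using lcos_self[OF _ H] l_repr_independence[OF _ _ H] l_coset_carrier[OF _ _ H] by blast
qed

lemma (in group) sum_translate:
  assumes h: "h \<in> carrier G"
  shows "(\<Sum>g\<in>carrier G. f (h \<otimes> g)) = (\<Sum>g\<in>carrier G. f g)"
  by (rule sum.reindex_bij_witness[of _ "\<lambda>g. inv h \<otimes> g" "\<lambda>g. h \<otimes> g"])
    (use h in \<open>auto simp: m_assoc[symmetric]\<close>)

text \<open>The trivial coset in the i-th summand, as a point mass. It is fixed by
  \<open>Hs ! i\<close> and its translates span that summand, so a homomorphism is determined by its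
  values on these generators.\<close>

definition perm_delta :: "'g set list \<Rightarrow> nat \<Rightarrow> nat \<Rightarrow> 'g set \<Rightarrow> complex"
  where "perm_delta Hs i = (\<lambda>j C. if j = i \<and> C = Hs ! i then 1 else 0)"

lemma (in group) perm_delta_in_space:
  assumes "subgroup (Hs ! i) G" "i < length Hs"
  shows "perm_delta Hs i \<in> dsum_perm_space G Hs"
proof -
  have "Hs ! i = \<one> <# (Hs ! i)"
    using assms subgroup.subset[OF assms(1)] by (simp add: lcos_mult_one)
  then have "Hs ! i \<in> lcosets (Hs ! i)" by (auto simp: LCOSETS_def)
  then show ?thesis
    using assms by (auto simp: perm_delta_def dsum_perm_space_def dsum_space_def perm_space_def)
qed

lemma (in group) perm_act_delta:
  assumes H: "\<forall>H\<in>set Hs. subgroup H G" and i: "i < length Hs" and g: "g \<in> carrier G"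
  shows "dsum_perm_act G Hs g (perm_delta Hs i)
    = (\<lambda>j C. if j = i \<and> C = g <# (Hs ! i) then 1 else 0)"
proof (intro ext)
  fix j C
  have Hi: "subgroup (Hs ! i) G" using H i by simp
  note sub = subgroup.subset[OF Hi]
  have "inv g <# C = Hs ! i \<longleftrightarrow> C = g <# (Hs ! i)" if "C \<in> lcosets (Hs ! i)"
  proof -
    have C: "C \<subseteq> carrier G" using subgroup.lcosets_carrier[OF Hi is_group that] .
    have "g <# (inv g <# C) = C" and "inv g <# (g <# (Hs ! i)) = Hs ! i"
      using g sub C by (simp_all add: lcos_m_assoc lcos_mult_one)
    then show ?thesis by auto
  qed
  moreover have "g <# (Hs ! i) \<in> lcosets (Hs ! i)" using g by (auto simp: LCOSETS_def)
  ultimately show "dsum_perm_act G Hs g (perm_delta Hs i) j C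
      = (if j = i \<and> C = g <# (Hs ! i) then 1 else 0)"
    using i by (auto simp: dsum_perm_act_def dsum_act_def perm_act_def perm_delta_def)
qed

lemma (in group) perm_act_delta_fixed:
  assumes H: "\<forall>H\<in>set Hs. subgroup H G" and i: "i < length Hs" and h: "h \<in> Hs ! i"
  shows "dsum_perm_act G Hs h (perm_delta Hs i) = perm_delta Hs i"
proof -
  have Hi: "subgroup (Hs ! i) G" using H i by simp
  have hG: "h \<in> carrier G" using subgroup.mem_carrier[OF Hi h] .
  show ?thesis
    using perm_act_delta[OF H i hG] h l_coset_eq_self_iff[OF Hi hG] by (simp add: perm_delta_def)
qed

text \<open>At a position j and a coset C only the terms with i = j and g in C survive. There are
  |C| = |Hs ! j| of them, each equal to \<open>f j C\<close> divided by that order. The coefficients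
  are those of \<open>perm_eval\<close>, so a linear map can be computed on \<open>f\<close> from
  the translated generators.\<close>

lemma (in group) perm_delta_expansion:
  assumes fin: "finite (carrier G)" and H: "\<forall>H\<in>set Hs. subgroup H G"
    and f: "f \<in> dsum_perm_space G Hs"
  shows "f = (\<Sum>(i, g)\<in>{..<length Hs} \<times> carrier G. fun_scale (fun_scale (*))
    (f i (g <# (Hs ! i)) / of_nat (card (Hs ! i))) (dsum_perm_act G Hs g (perm_delta Hs i)))"
    (is "f = ?s")
proof (intro ext)
  fix j C
  have "?s j C = (\<Sum>(i, g)\<in>{..<length Hs} \<times> carrier G.
      f i (g <# (Hs ! i)) / of_nat (card (Hs ! i)) * (if j = i \<and> C = g <# (Hs ! i) then 1 else 0))"
  proof -
    have "(\<Sum>k\<in>K. F k) j C = (\<Sum>k\<in>K. F k j C)"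
      for K :: "(nat \<times> 'a) set" and F :: "_ \<Rightarrow> nat \<Rightarrow> 'a set \<Rightarrow> complex"
      by (induction K rule: infinite_finite_induct) auto
    then show ?thesis
      by (auto intro!: sum.cong simp: perm_act_delta[OF H] fun_scale_def)
  qed
  also have "\<dots> = (\<Sum>i<length Hs. \<Sum>g\<in>carrier G.
      f i (g <# (Hs ! i)) / of_nat (card (Hs ! i)) * (if j = i \<and> C = g <# (Hs ! i) then 1 else 0))"
    by (simp add: sum.cartesian_product)
  also have "\<dots> = (\<Sum>i<length Hs. if i = j then
      (\<Sum>g\<in>carrier G. if C = g <# (Hs ! j) then f j C / of_nat (card (Hs ! j)) else 0) else 0)"
    by (intro sum.cong refl) (auto intro!: sum.cong)
  also have "\<dots> = (if j < length Hs then
      of_nat (card {g \<in> carrier G. g <# (Hs ! j) = C}) * (f j C / of_nat (card (Hs ! j))) else 0)"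
    using fin by (simp add: sum.If_cases Int_def eq_commute[of C])
  also have "\<dots> = f j C"
  proof (cases "j < length Hs \<and> C \<in> lcosets (Hs ! j)")
    case True
    then have Hj: "subgroup (Hs ! j) G" using H by simp
    have "card (Hs ! j) = card C"
      using l_card_cosets_equal[OF _ subgroup.subset[OF Hj] fin] True by simp
    moreover have "card (Hs ! j) > 0"
      using subgroup.finite_imp_card_positive[OF Hj fin] .
    ultimately show ?thesis using True by (simp add: l_coset_fibre[OF Hj])
  next
    case False
    moreover have "if j < length Hs then f j \<in> perm_space G (Hs ! j) else f j = 0"
      using f by (simp add: dsum_perm_space_def dsum_space_def)
    ultimately have "f j C = 0" by (auto simp: perm_space_def split: if_splits)
    then show ?thesis by simp
  qed
  finally show "f j C = ?s j C" by simp
qed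

section \<open>Frobenius reciprocity: homomorphisms from permutation modules as fixed
  vectors\<close>

locale finite_group_rep = complex_rep G scale V act + complex_vector_space scale
  for G :: "('g, 'm) monoid_scheme" (structure)
    and scale :: "complex \<Rightarrow> 'v::ab_group_add \<Rightarrow> 'v" and V and act +
  assumes finite_carrier: "finite (carrier G)"
begin

definition fixed_sum :: "'g set list \<Rightarrow> (nat \<Rightarrow> 'v) set"
  where "fixed_sum Hs = dsum_space (length Hs) (\<lambda>i. fixed_space V act (Hs ! i))"

text \<open>The \<open>G\<close>-homomorphism from the permutation module to \<open>V\<close> that corresponds to \<open>y\<close>, the map
  with \<open>perm_delta Hs i \<mapsto> y i\<close>, under \<open>Hom\<^sub>G(\<Oplus>\<^sub>i \<complex>[G/H\<^sub>i], V) \<cong> \<Oplus>\<^sub>i V\<^bsup>H\<^sub>i\<^esup>\<close>. Summation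
  over \<open>G\<close> instead of \<open>G/H\<^sub>i\<close> avoids a choice of coset representatives.\<close>

definition perm_eval :: "'g set list \<Rightarrow> (nat \<Rightarrow> 'v) \<Rightarrow> (nat \<Rightarrow> 'g set \<Rightarrow> complex) \<Rightarrow> 'v"
  where "perm_eval Hs y f = (\<Sum>(i, g)\<in>{..<length Hs} \<times> carrier G.
    scale (f i (g <# (Hs ! i)) / of_nat (card (Hs ! i))) (act g (y i)))"

lemma fixed_sum_nth:
  "y \<in> fixed_sum Hs \<Longrightarrow> i < length Hs \<Longrightarrow> y i \<in> fixed_space V act (Hs ! i)"
  unfolding fixed_sum_def dsum_space_def by (auto dest: spec[of _ i])

lemma fixed_sum_in_V: "y \<in> fixed_sum Hs \<Longrightarrow> i < length Hs \<Longrightarrow> y i \<in> V"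
  using fixed_sum_nth by (fastforce simp: fixed_space_def)

lemma act_sum:
  assumes g: "g \<in> carrier G" and x: "\<And>k. k \<in> I \<Longrightarrow> x k \<in> V"
  shows "act g (\<Sum>k\<in>I. scale (c k) (x k)) = (\<Sum>k\<in>I. scale (c k) (act g (x k)))"
  by (rule linear_on_sum[OF vector_space_axioms vector_space_axioms subspace_V])
    (use g x in \<open>simp_all add: act_add act_scale\<close>)

lemma perm_eval_closed:
  assumes "y \<in> fixed_sum Hs"
  shows "perm_eval Hs y f \<in> V"
  unfolding perm_eval_def
  by (intro subspace_sum subspace_V)
    (auto intro!: subspace_scale subspace_V act_closed fixed_sum_in_V[OF assms])

lemma perm_eval_add: "perm_eval Hs y (f + f') = perm_eval Hs y f + perm_eval Hs y f'"
  by (simp add: perm_eval_def sum.distrib[symmetric] case_prod_beta add_divide_distrib scale_left_distrib)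

lemma perm_eval_scale: "perm_eval Hs y (fun_scale (fun_scale (*)) c f) = scale c (perm_eval Hs y f)"
  by (simp add: perm_eval_def scale_sum_right case_prod_beta fun_scale_def)

lemma perm_eval_add_right:
  assumes "y \<in> fixed_sum Hs" "y' \<in> fixed_sum Hs"
  shows "perm_eval Hs (y + y') f = perm_eval Hs y f + perm_eval Hs y' f"
  unfolding perm_eval_def sum.distrib[symmetric]
  using assms by (intro sum.cong) (auto simp: act_add fixed_sum_in_V scale_right_distrib)

lemma perm_eval_scale_right:
  assumes "y \<in> fixed_sum Hs"
  shows "perm_eval Hs (fun_scale scale c y) f = scale c (perm_eval Hs y f)"
  unfolding perm_eval_def scale_sum_right
  using assms by (intro sum.cong) (auto simp: act_scale fixed_sum_in_V fun_scale_def mult.commute)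

text \<open>Only the g in \<open>Hs ! i\<close> have a nonzero coefficient, and they fix
  \<open>y i\<close>; this leaves |Hs ! i| equal terms. So \<open>y\<close> can be recovered from
  its homomorphism.\<close>

lemma perm_eval_delta:
  assumes H: "subgroup (Hs ! i) G" and i: "i < length Hs" and y: "y \<in> fixed_sum Hs"
  shows "perm_eval Hs y (perm_delta Hs i) = y i"
proof -
  let ?H = "Hs ! i"
  have yi: "act g (y i) = y i" if "g \<in> ?H" for g
    using fixed_sum_nth[OF y i] that by (simp add: fixed_space_def)
  have "perm_eval Hs y (perm_delta Hs i) = (\<Sum>j<length Hs. \<Sum>g\<in>carrier G.
      scale (perm_delta Hs i j (g <# (Hs ! j)) / of_nat (card (Hs ! j))) (act g (y j)))"
    by (simp add: perm_eval_def sum.cartesian_product)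
  also have "\<dots> = (\<Sum>j<length Hs. if j = i then
      (\<Sum>g\<in>carrier G. if g \<in> ?H then scale (1 / of_nat (card ?H)) (y i) else 0) else 0)"
    by (intro sum.cong refl)
      (auto intro!: sum.cong simp: perm_delta_def l_coset_eq_self_iff[OF H] yi)
  also have "\<dots> = (\<Sum>g\<in>carrier G \<inter> ?H. scale (1 / of_nat (card ?H)) (y i))"
    using i finite_carrier by (simp add: sum.inter_restrict)
  also have "carrier G \<inter> ?H = ?H" using subgroup.subset[OF H] by blast
  also have "(\<Sum>g\<in>?H. scale (1 / of_nat (card ?H)) (y i)) = scale (of_nat (card ?H) * (1 / of_nat (card ?H))) (y i)"
    by (simp only: scale_sum_left[symmetric] sum_constant)
  also have "\<dots> = y i"
    using subgroup.finite_imp_card_positive[OF H finite_carrier] by simp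
  finally show ?thesis .
qed

text \<open>The action of \<open>h\<close> shifts the coefficients by \<open>inv h\<close>;
  substituting \<open>h \<otimes> g\<close> for \<open>g\<close> moves the shift onto the vectors.
  With a sum over the whole group this is a plain reindexing.\<close>

lemma perm_eval_act:
  assumes H: "\<forall>H\<in>set Hs. subgroup H G" and h: "h \<in> carrier G" and y: "y \<in> fixed_sum Hs"
  shows "perm_eval Hs y (dsum_perm_act G Hs h f) = act h (perm_eval Hs y f)"
proof -
  let ?c = "\<lambda>i g. f i (g <# (Hs ! i)) / of_nat (card (Hs ! i))"
  have "perm_eval Hs y (dsum_perm_act G Hs h f) = (\<Sum>i<length Hs. \<Sum>g\<in>carrier G.
      scale (dsum_perm_act G Hs h f i (g <# (Hs ! i)) / of_nat (card (Hs ! i))) (act g (y i)))"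
    by (simp add: perm_eval_def sum.cartesian_product)
  also have "\<dots> = (\<Sum>i<length Hs. \<Sum>g\<in>carrier G. scale (?c i (inv h \<otimes> g)) (act g (y i)))"
  proof (intro sum.cong refl)
    fix i g assume "i \<in> {..<length Hs}" and g: "g \<in> carrier G"
    then have i: "i < length Hs" and Hi: "subgroup (Hs ! i) G" using H by auto
    have "g <# (Hs ! i) \<in> lcosets (Hs ! i)" using g by (auto simp: LCOSETS_def)
    then show "scale (dsum_perm_act G Hs h f i (g <# (Hs ! i)) / of_nat (card (Hs ! i))) (act g (y i))
        = scale (?c i (inv h \<otimes> g)) (act g (y i))"
      using i g h subgroup.subset[OF Hi]
      by (simp add: dsum_perm_act_def dsum_act_def perm_act_def lcos_m_assoc)
  qed
  also have "\<dots> = (\<Sum>i<length Hs. \<Sum>g\<in>carrier G. scale (?c i g) (act h (act g (y i))))"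
  proof (rule sum.cong[OF refl])
    fix i assume i: "i \<in> {..<length Hs}"
    have "(\<Sum>g\<in>carrier G. scale (?c i (inv h \<otimes> g)) (act g (y i)))
        = (\<Sum>g\<in>carrier G. scale (?c i (inv h \<otimes> (h \<otimes> g))) (act (h \<otimes> g) (y i)))"
      by (rule sum_translate[OF h, symmetric])
    also have "\<dots> = (\<Sum>g\<in>carrier G. scale (?c i g) (act h (act g (y i))))"
      using i h y by (intro sum.cong refl)
        (simp add: m_assoc[symmetric] act_mult fixed_sum_in_V)
    finally show "(\<Sum>g\<in>carrier G. scale (?c i (inv h \<otimes> g)) (act g (y i)))
        = (\<Sum>g\<in>carrier G. scale (?c i g) (act h (act g (y i))))" .
  qed
  also have "\<dots> = (\<Sum>(i, g)\<in>{..<length Hs} \<times> carrier G. scale (?c i g) (act h (act g (y i))))"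
    by (simp add: sum.cartesian_product)
  also have "\<dots> = act h (perm_eval Hs y f)"
    using act_sum[OF h, of "{..<length Hs} \<times> carrier G" "\<lambda>(i, g). act g (y i)" "\<lambda>(i, g). ?c i g"] y
    by (auto simp: perm_eval_def case_prod_beta act_closed fixed_sum_in_V)
  finally show ?thesis .
qed

text \<open>Precomposition with \<open>F\<close>, read through the correspondence of \<open>perm_eval\<close>.\<close>

definition transfer ::
  "'g set list \<Rightarrow> 'g set list \<Rightarrow> ((nat \<Rightarrow> 'g set \<Rightarrow> complex) \<Rightarrow> nat \<Rightarrow> 'g set \<Rightarrow> complex) \<Rightarrow>
   (nat \<Rightarrow> 'v) \<Rightarrow> nat \<Rightarrow> 'v"
  where "transfer Hs Hs' F y =
    (\<lambda>i. if i < length Hs then perm_eval Hs' y (F (perm_delta Hs i)) else 0)"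

lemma transfer_add:
  assumes "y \<in> fixed_sum Hs'" "y' \<in> fixed_sum Hs'"
  shows "transfer Hs Hs' F (y + y') = transfer Hs Hs' F y + transfer Hs Hs' F y'"
  using assms by (auto simp: transfer_def fun_eq_iff perm_eval_add_right)

lemma transfer_scale:
  assumes "y \<in> fixed_sum Hs'"
  shows "transfer Hs Hs' F (fun_scale scale c y) = fun_scale scale c (transfer Hs Hs' F y)"
  using assms unfolding transfer_def
  by (auto simp: fun_eq_iff perm_eval_scale_right) (auto simp: fun_scale_def)

end

section \<open>Homomorphisms of permutation modules and the maps they induce on fixed
  vectors\<close>

locale perm_hom = finite_group_rep G scale V act
  for G :: "('g, 'm) monoid_scheme" (structure)
    and scale :: "complex \<Rightarrow> 'v::ab_group_add \<Rightarrow> 'v" and V and act +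
  fixes Hs Hs' :: "'g set list"
    and F :: "(nat \<Rightarrow> 'g set \<Rightarrow> complex) \<Rightarrow> nat \<Rightarrow> 'g set \<Rightarrow> complex"
  assumes subgroups: "\<forall>H\<in>set Hs. subgroup H G" "\<forall>H\<in>set Hs'. subgroup H G"
    and F_closed: "f \<in> dsum_perm_space G Hs \<Longrightarrow> F f \<in> dsum_perm_space G Hs'"
    and F_add: "\<lbrakk>f \<in> dsum_perm_space G Hs; f' \<in> dsum_perm_space G Hs\<rbrakk> \<Longrightarrow> F (f + f') = F f + F f'"
    and F_scale: "f \<in> dsum_perm_space G Hs \<Longrightarrow>
      F (fun_scale (fun_scale (*)) c f) = fun_scale (fun_scale (*)) c (F f)"
    and F_act: "\<lbrakk>g \<in> carrier G; f \<in> dsum_perm_space G Hs\<rbrakk> \<Longrightarrow>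
      F (dsum_perm_act G Hs g f) = dsum_perm_act G Hs' g (F f)"
begin

lemma perm_delta_closed: "i < length Hs \<Longrightarrow> perm_delta Hs i \<in> dsum_perm_space G Hs"
  using subgroups by (intro perm_delta_in_space) auto

text \<open>The generator \<open>perm_delta Hs i\<close> is fixed by \<open>Hs ! i\<close>, and both
  \<open>F\<close> and \<open>perm_eval\<close> commute with the group, so its image in
  \<open>V\<close> is fixed as well.\<close>

lemma transfer_closed:
  assumes y: "y \<in> fixed_sum Hs'"
  shows "transfer Hs Hs' F y \<in> fixed_sum Hs"
proof -
  have "act h (perm_eval Hs' y (F (perm_delta Hs i))) = perm_eval Hs' y (F (perm_delta Hs i))"
    if i: "i < length Hs" and h: "h \<in> Hs ! i" for i h
  proof -
    have hG: "h \<in> carrier G" using subgroups(1) i h subgroup.mem_carrier[of "Hs ! i" G h] by auto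
    have "act h (perm_eval Hs' y (F (perm_delta Hs i)))
        = perm_eval Hs' y (F (dsum_perm_act G Hs h (perm_delta Hs i)))"
      by (simp add: perm_eval_act[OF subgroups(2) hG y] F_act[OF hG perm_delta_closed[OF i]])
    then show ?thesis by (simp add: perm_act_delta_fixed[OF subgroups(1) i h])
  qed
  then show ?thesis
    using perm_eval_closed[OF y]
    by (auto simp: transfer_def fixed_sum_def dsum_space_def fixed_space_def)
qed

text \<open>Both sides are linear in \<open>f\<close> and agree on the translates of the generators,
  so the expansion of \<open>f\<close> settles it. This justifies reading \<open>transfer\<close> as
  precomposition with \<open>F\<close>.\<close>

lemma perm_eval_transfer:
  assumes y: "y \<in> fixed_sum Hs'" and f: "f \<in> dsum_perm_space G Hs"
  shows "perm_eval Hs (transfer Hs Hs' F y) f = perm_eval Hs' y (F f)"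
proof -
  let ?I = "{..<length Hs} \<times> carrier G"
  let ?c = "\<lambda>(i, g). f i (g <# (Hs ! i)) / of_nat (card (Hs ! i))"
  let ?d = "\<lambda>(i, g). dsum_perm_act G Hs g (perm_delta Hs i)"
  interpret P: complex_rep G "fun_scale (fun_scale (*))" "dsum_perm_space G Hs" "dsum_perm_act G Hs"
    by (rule complex_rep_dsum_perm[OF subgroups(1)])
  have d: "?d k \<in> dsum_perm_space G Hs" if "k \<in> ?I" for k
    using that perm_delta_closed by (auto simp: P.act_closed)
  have "perm_eval Hs' y (F f)
      = perm_eval Hs' y (F (\<Sum>k\<in>?I. fun_scale (fun_scale (*)) (?c k) (?d k)))"
    using perm_delta_expansion[OF finite_carrier subgroups(1) f] by (simp add: case_prod_beta)
  also have "\<dots> = (\<Sum>k\<in>?I. scale (?c k) (perm_eval Hs' y (F (?d k))))"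
    by (rule linear_on_sum[OF P.vector_space_axioms vector_space_axioms P.subspace_V])
      (use d in \<open>simp_all only: F_add F_scale perm_eval_add perm_eval_scale\<close>)
  also have "\<dots> = (\<Sum>(i, g)\<in>?I. scale (?c (i, g)) (act g (transfer Hs Hs' F y i)))"
    by (rule sum.cong)
      (auto simp: F_act perm_delta_closed perm_eval_act[OF subgroups(2) _ y] transfer_def)
  finally show ?thesis by (simp add: perm_eval_def case_prod_beta)
qed

text \<open>Precomposition commutes with postcomposition. Since A is linear and equivariant,
  postcomposing with A amounts to applying A to each component of \<open>y\<close>.\<close>

lemma transfer_commute:
  assumes A: "\<And>v. v \<in> V \<Longrightarrow> A v \<in> V"
    and A_add: "\<And>v w. \<lbrakk>v \<in> V; w \<in> V\<rbrakk> \<Longrightarrow> A (v + w) = A v + A w"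
    and A_scale: "\<And>c v. v \<in> V \<Longrightarrow> A (scale c v) = scale c (A v)"
    and A_act: "\<And>g v. \<lbrakk>g \<in> carrier G; v \<in> V\<rbrakk> \<Longrightarrow> A (act g v) = act g (A v)"
    and y: "y \<in> fixed_sum Hs'"
  shows "transfer Hs Hs' F (\<lambda>i. A (y i)) = (\<lambda>i. A (transfer Hs Hs' F y i))"
proof -
  \<comment> \<open>Takes care of the positions from \<open>length Hs\<close> on, where
    \<open>transfer\<close> is 0 by default.\<close>
  have A0: "A 0 = 0" using A_scale[of 0 0] subspace_0[OF subspace_V] by simp
  have "perm_eval Hs' (\<lambda>i. A (y i)) f = A (perm_eval Hs' y f)" for f
  proof -
    let ?I = "{..<length Hs'} \<times> carrier G"
    let ?c = "\<lambda>(i, g). f i (g <# (Hs' ! i)) / of_nat (card (Hs' ! i))"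
    have "A (\<Sum>k\<in>?I. scale (?c k) (case k of (i, g) \<Rightarrow> act g (y i)))
        = (\<Sum>k\<in>?I. scale (?c k) (A (case k of (i, g) \<Rightarrow> act g (y i))))"
      by (rule linear_on_sum[OF vector_space_axioms vector_space_axioms subspace_V])
        (use y in \<open>auto simp: A_add A_scale act_closed fixed_sum_in_V\<close>)
    also have "\<dots> = perm_eval Hs' (\<lambda>i. A (y i)) f"
      unfolding perm_eval_def
      by (rule sum.cong) (use y in \<open>auto simp: A_act fixed_sum_in_V\<close>)
    finally show ?thesis by (simp add: perm_eval_def case_prod_beta)
  qed
  then show ?thesis by (auto simp: transfer_def fun_eq_iff A0)
qed

end

text \<open>By contravariance the composite is precomposition with \<open>F\<close> after
  \<open>F'\<close>, which is the identity; evaluating at the generators recovers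
  \<open>y\<close>.\<close>

lemma (in finite_group_rep) transfer_inverse:
  assumes F: "perm_hom G scale V act Hs Hs' F" and F': "perm_hom G scale V act Hs' Hs F'"
    and FF': "\<And>f. f \<in> dsum_perm_space G Hs' \<Longrightarrow> F (F' f) = f"
    and y: "y \<in> fixed_sum Hs'"
  shows "transfer Hs' Hs F' (transfer Hs Hs' F y) = y"
proof
  fix j
  interpret F: perm_hom G scale V act Hs Hs' F by fact
  interpret F': perm_hom G scale V act Hs' Hs F' by fact
  show "transfer Hs' Hs F' (transfer Hs Hs' F y) j = y j"
  proof (cases "j < length Hs'")
    case True
    then have d: "perm_delta Hs' j \<in> dsum_perm_space G Hs'" by (rule F'.perm_delta_closed)
    have "perm_eval Hs (transfer Hs Hs' F y) (F' (perm_delta Hs' j))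
        = perm_eval Hs' y (perm_delta Hs' j)"
      using F.perm_eval_transfer[OF y F'.F_closed[OF d]] FF'[OF d] by simp
    also have "\<dots> = y j" using F.subgroups(2) True y by (intro perm_eval_delta) auto
    finally show ?thesis using True by (simp add: transfer_def)
  next
    case False
    then show ?thesis using y by (auto simp: transfer_def fixed_sum_def dsum_space_def)
  qed
qed

section \<open>Comparison of two invariant inner products\<close>

text \<open>\<open>A v\<close> is the Riesz vector of the second form at \<open>v\<close>, and its
  uniqueness reduces every law to an identity between forms. Equivariance needs invariance of both
  forms: of the second to remove \<open>g\<close> from \<open>act g v\<close>, of the first to put
  it back in front of \<open>A v\<close>.\<close>

lemma (in finite_group_rep) equivariant_operator:
  assumes es: "set es \<subseteq> V" "V \<subseteq> span (set es)" "list_independent es"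
    and ip\<^sub>1: "hermitian_inner_product scale V ip\<^sub>1" "invariant_form G V act ip\<^sub>1"
    and ip\<^sub>2: "hermitian_inner_product scale V ip\<^sub>2" "invariant_form G V act ip\<^sub>2"
  obtains A where
    "\<And>v. v \<in> V \<Longrightarrow> A v \<in> V"
    "\<And>v w. \<lbrakk>v \<in> V; w \<in> V\<rbrakk> \<Longrightarrow> A (v + w) = A v + A w"
    "\<And>c v. v \<in> V \<Longrightarrow> A (scale c v) = scale c (A v)"
    "\<And>g v. \<lbrakk>g \<in> carrier G; v \<in> V\<rbrakk> \<Longrightarrow> A (act g v) = act g (A v)"
    "\<And>v w. \<lbrakk>v \<in> V; w \<in> V\<rbrakk> \<Longrightarrow> ip\<^sub>2 v w = ip\<^sub>1 (A v) w"
proof -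
  interpret h1: hermitian_space scale V ip\<^sub>1 by unfold_locales (rule subspace_V, rule ip\<^sub>1)
  interpret h2: hermitian_space scale V ip\<^sub>2 by unfold_locales (rule subspace_V, rule ip\<^sub>2)
  have "\<exists>u. u \<in> V \<and> (\<forall>w\<in>V. ip\<^sub>1 u w = ip\<^sub>2 v w)" if "v \<in> V" for v
    using h1.riesz_representation[OF es ip\<^sub>2(1) that] by metis
  then obtain A where A: "\<And>v. v \<in> V \<Longrightarrow> A v \<in> V"
    and A_ip: "\<And>v w. \<lbrakk>v \<in> V; w \<in> V\<rbrakk> \<Longrightarrow> ip\<^sub>1 (A v) w = ip\<^sub>2 v w"
    by metis
  note V_add = subspace_add[OF subspace_V] and V_scale = subspace_scale[OF subspace_V]
  show thesis
  proof (rule that[of A])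
    show "A v \<in> V" if "v \<in> V" for v using A that .
    show "ip\<^sub>2 v w = ip\<^sub>1 (A v) w" if "v \<in> V" "w \<in> V" for v w using A_ip that by simp
    show "A (v + w) = A v + A w" if "v \<in> V" "w \<in> V" for v w
      by (rule h1.ip_eqI) (use that in \<open>simp_all add: A V_add A_ip h1.ip_add h2.ip_add\<close>)
    show "A (scale c v) = scale c (A v)" if "v \<in> V" for c v
      by (rule h1.ip_eqI) (use that in \<open>simp_all add: A V_scale A_ip h1.ip_scale h2.ip_scale\<close>)
    show "A (act g v) = act g (A v)" if g: "g \<in> carrier G" and v: "v \<in> V" for g v
    proof (rule h1.ip_eqI)
      fix w assume w: "w \<in> V"
      have w': "act (inv g) w \<in> V" using g w by (simp add: act_closed)
      \<comment> \<open>Invariance moves both arguments at once, so \<open>w\<close> is written as a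
        translate by \<open>g\<close>.\<close>
      have w_eq: "act g (act (inv g) w) = w"
        using g w by (simp add: act_mult[symmetric] act_one)
      have "ip\<^sub>1 (A (act g v)) w = ip\<^sub>2 (act g v) (act g (act (inv g) w))"
        using g v w by (simp add: A_ip act_closed w_eq)
      also have "\<dots> = ip\<^sub>1 (A v) (act (inv g) w)"
        using ip\<^sub>2(2) g v w' by (simp add: invariant_form_def A_ip)
      also have "\<dots> = ip\<^sub>1 (act g (A v)) (act g (act (inv g) w))"
        using ip\<^sub>1(2) g A[OF v] w' by (simp add: invariant_form_def)
      finally show "ip\<^sub>1 (A (act g v)) w = ip\<^sub>1 (act g (A v)) w" by (simp add: w_eq)
    qed (use g v in \<open>simp_all add: A act_closed\<close>)
  qed
qed

text \<open>The inverse of a bijective homomorphism is a homomorphism: by injectivity, in the form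
  of \<open>F'I\<close>, each law for \<open>F'\<close> is checked after applying
  \<open>F\<close>.\<close>

lemma (in finite_group_rep) perm_relation_homs:
  assumes "perm_relation G Hs Hs'"
  obtains F F' where "perm_hom G scale V act Hs Hs' F" "perm_hom G scale V act Hs' Hs F'"
    "\<forall>f\<in>dsum_perm_space G Hs'. F (F' f) = f" "\<forall>f\<in>dsum_perm_space G Hs. F' (F f) = f"
proof -
  let ?S = "dsum_perm_space G Hs" and ?S' = "dsum_perm_space G Hs'"
  have H: "\<forall>H\<in>set Hs. subgroup H G" "\<forall>H\<in>set Hs'. subgroup H G"
    using assms by (auto simp: perm_relation_def)
  interpret P: complex_rep G "fun_scale (fun_scale (*))" ?S "dsum_perm_act G Hs"
    by (rule complex_rep_dsum_perm[OF H(1)])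
  interpret P': complex_rep G "fun_scale (fun_scale (*))" ?S' "dsum_perm_act G Hs'"
    by (rule complex_rep_dsum_perm[OF H(2)])
  obtain F where bij: "bij_betw F ?S ?S'"
    and add: "\<And>f f'. \<lbrakk>f \<in> ?S; f' \<in> ?S\<rbrakk> \<Longrightarrow> F (f + f') = F f + F f'"
    and sc: "\<And>c f. f \<in> ?S \<Longrightarrow> F (fun_scale (fun_scale (*)) c f) = fun_scale (fun_scale (*)) c (F f)"
    and ac: "\<And>g f. \<lbrakk>g \<in> carrier G; f \<in> ?S\<rbrakk> \<Longrightarrow>
        F (dsum_perm_act G Hs g f) = dsum_perm_act G Hs' g (F f)"
    using assms unfolding perm_relation_def rep_isomorphic_def by blast
  define F' where "F' = inv_into ?S F"
  have F: "F f \<in> ?S'" if "f \<in> ?S" for f using bij that by (auto simp: bij_betw_def)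
  have F': "F' f \<in> ?S" if "f \<in> ?S'" for f
    using bij that by (auto simp: F'_def bij_betw_def intro: inv_into_into)
  have FF': "F (F' f) = f" if "f \<in> ?S'" for f
    using bij that by (auto simp: F'_def bij_betw_def f_inv_into_f)
  have F'F: "F' (F f) = f" if "f \<in> ?S" for f
    using bij that by (auto simp: F'_def bij_betw_def inv_into_f_f)
  have F'I: "F' f = u" if "u \<in> ?S" "F u = f" for f u using F'F that by blast
  show thesis
  proof (rule that[of F F'])
    show "\<forall>f\<in>?S'. F (F' f) = f" "\<forall>f\<in>?S. F' (F f) = f" using FF' F'F by blast+
    show "perm_hom G scale V act Hs Hs' F"
      by unfold_locales (use H F add sc ac in blast)+
    show "perm_hom G scale V act Hs' Hs F'"
    proof unfold_locales
      show "F' (f + f') = F' f + F' f'" if "f \<in> ?S'" "f' \<in> ?S'" for f f'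
        by (rule F'I) (use that F' FF' in \<open>simp_all only: P.subspace_add[OF P.subspace_V] add\<close>)
      show "F' (fun_scale (fun_scale (*)) c f) = fun_scale (fun_scale (*)) c (F' f)"
        if "f \<in> ?S'" for c f
        by (rule F'I) (use that F' FF' in \<open>simp_all only: P.subspace_scale[OF P.subspace_V] sc\<close>)
      show "F' (dsum_perm_act G Hs' g f) = dsum_perm_act G Hs g (F' f)"
        if "g \<in> carrier G" "f \<in> ?S'" for g f
        by (rule F'I) (use that F' FF' in \<open>simp_all only: P.act_closed ac\<close>)
    qed (use H F' in blast)+
  qed
qed

text \<open>Summands are indexed by positions in \<open>Hs\<close>, so a repeated subgroup
  contributes one summand per occurrence, as it does one factor to the product.\<close>

lemma (in finite_group_rep) prod_scaled_gram_det:
  assumes ip: "hermitian_inner_product scale V ip"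
    and basis: "\<And>H. H \<in> set Hs \<Longrightarrow> set (basis H) \<subseteq> V"
  shows "(\<Prod>H\<leftarrow>Hs. scaled_gram_det ip H (basis H)) =
    det (gram_matrix (dsum_form (length Hs) (\<lambda>i. card (Hs ! i)) ip)
      (dsum_basis (length Hs) (\<lambda>i. basis (Hs ! i))))"
proof -
  interpret hermitian_space scale V ip by unfold_locales (rule subspace_V, rule ip)
  have "map (\<lambda>H. scaled_gram_det ip H (basis H)) Hs
      = map (\<lambda>i. scaled_gram_det ip (Hs ! i) (basis (Hs ! i))) [0..<length Hs]"
    by (intro nth_equalityI) auto
  then show ?thesis
    using basis by (subst det_gram_matrix_dsum_basis) (simp_all add: scaled_gram_det_def)
qed

theorem theorem2p19:
  fixes G :: "('g, 'm) monoid_scheme"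
    and Hs Hs' :: "'g set list"
    and scale :: "complex \<Rightarrow> 'v::ab_group_add \<Rightarrow> 'v"
    and V :: "'v set"
    and act :: "'g \<Rightarrow> 'v \<Rightarrow> 'v"
    and ip\<^sub>1 ip\<^sub>2 :: "'v \<Rightarrow> 'v \<Rightarrow> complex"
    and basis :: "'g set \<Rightarrow> 'v list"
  assumes "group G" and "finite (carrier G)"
    and "perm_relation G Hs Hs'"
    and "fin_dim_complex_rep G scale V act"
    and "hermitian_inner_product scale V ip\<^sub>1" and "invariant_form G V act ip\<^sub>1"
    and "hermitian_inner_product scale V ip\<^sub>2" and "invariant_form G V act ip\<^sub>2"
    and "\<And>H. subgroup H G \<Longrightarrow> vector_space.ordered_basis scale (fixed_space V act H) (basis H)"
  shows "(\<Prod>H\<leftarrow>Hs. scaled_gram_det ip\<^sub>1 H (basis H)) / (\<Prod>H\<leftarrow>Hs'. scaled_gram_det ip\<^sub>1 H (basis H))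
       = (\<Prod>H\<leftarrow>Hs. scaled_gram_det ip\<^sub>2 H (basis H)) / (\<Prod>H\<leftarrow>Hs'. scaled_gram_det ip\<^sub>2 H (basis H))"
proof -
  interpret fin_dim_complex_rep G scale V act by fact
  interpret finite_group_rep G scale V act by unfold_locales fact
  interpret f: complex_vector_space "fun_scale scale :: complex \<Rightarrow> (nat \<Rightarrow> 'v) \<Rightarrow> _"
    by (rule complex_vector_space_fun_scale)
  have basis: "set (basis H) \<subseteq> fixed_space V act H" "fixed_space V act H \<subseteq> span (set (basis H))"
    "list_independent (basis H)" if "subgroup H G" for H
    using assms(9)[OF that] span_superset ordered_basis_list_independent
    by (auto simp: ordered_basis_def)
  have basis_V: "set (basis H) \<subseteq> V" if "subgroup H G" for H
    using basis(1)[OF that] by (auto simp: fixed_space_def)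
  \<comment> \<open>The trivial subgroup fixes all of \<open>V\<close>, so its chosen basis is the
    basis of \<open>V\<close> that Riesz representation asks for.\<close>
  let ?e = "basis {\<one>\<^bsub>G\<^esub>}"
  have "fixed_space V act {\<one>\<^bsub>G\<^esub>} = V" by (auto simp: fixed_space_def act_one)
  then have e: "set ?e \<subseteq> V" "V \<subseteq> span (set ?e)" "list_independent ?e"
    using basis[OF triv_subgroup] by simp_all
  obtain A where A: "\<And>v. v \<in> V \<Longrightarrow> A v \<in> V"
    and A_add: "\<And>v w. \<lbrakk>v \<in> V; w \<in> V\<rbrakk> \<Longrightarrow> A (v + w) = A v + A w"
    and A_scale: "\<And>c v. v \<in> V \<Longrightarrow> A (scale c v) = scale c (A v)"
    and A_act: "\<And>g v. \<lbrakk>g \<in> carrier G; v \<in> V\<rbrakk> \<Longrightarrow> A (act g v) = act g (A v)"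
    and A_ip: "\<And>v w. \<lbrakk>v \<in> V; w \<in> V\<rbrakk> \<Longrightarrow> ip\<^sub>2 v w = ip\<^sub>1 (A v) w"
    by (rule equivariant_operator[OF e assms(5-8)]) (rule that; blast)
  obtain F F' where F: "perm_hom G scale V act Hs Hs' F" and F': "perm_hom G scale V act Hs' Hs F'"
    and FF': "\<forall>f\<in>dsum_perm_space G Hs'. F (F' f) = f"
    and F'F: "\<forall>f\<in>dsum_perm_space G Hs. F' (F f) = f"
    by (rule perm_relation_homs[OF assms(3)])
  interpret F: perm_hom G scale V act Hs Hs' F by fact
  interpret F': perm_hom G scale V act Hs' Hs F' by fact

  define form where "form ip Ks = dsum_form (length Ks) (\<lambda>i. card (Ks ! i)) ip"
    for ip :: "'v \<Rightarrow> 'v \<Rightarrow> complex" and Ks :: "'g set list"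
  define bas where "bas Ks = dsum_basis (length Ks) (\<lambda>i. basis (Ks ! i))" for Ks
  \<comment> \<open>Transfer reverses direction: a map from the sum for \<open>Hs\<close> to the sum
    for \<open>Hs'\<close> comes from the inverse isomorphism \<open>F'\<close>.\<close>
  let ?T = "transfer Hs' Hs F'" and ?A = "\<lambda>x i. A (x i)"
  have A0: "A 0 = 0" using A_scale[of 0 0] subspace_0[OF subspace_V] by simp
  have A_closed: "?A x \<in> fixed_sum Hs" if "x \<in> fixed_sum Hs" for x
  proof -
    have "A v \<in> fixed_space V act (Hs ! i)" if "i < length Hs" "v \<in> fixed_space V act (Hs ! i)" for i v
    proof -
      have "h \<in> carrier G" if "h \<in> Hs ! i" for h
        using F.subgroups(1) \<open>i < length Hs\<close> that subgroup.mem_carrier[of "Hs ! i" G h] by auto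
      then show ?thesis
        using that A by (auto simp: fixed_space_def A_act[symmetric])
    qed
    then show ?thesis
      using \<open>x \<in> fixed_sum Hs\<close> by (simp add: fixed_sum_def dsum_space_def A0)
  qed
  have dsum: "f.subspace (fixed_sum Ks)"
    "hermitian_inner_product (fun_scale scale) (fixed_sum Ks) (form ip\<^sub>1 Ks)"
    "hermitian_inner_product (fun_scale scale) (fixed_sum Ks) (form ip\<^sub>2 Ks)"
    "set (bas Ks) \<subseteq> fixed_sum Ks" "fixed_sum Ks \<subseteq> f.span (set (bas Ks))"
    "f.list_independent (bas Ks)"
    "\<And>x y. \<lbrakk>x \<in> fixed_sum Ks; y \<in> fixed_sum Ks\<rbrakk> \<Longrightarrow> form ip\<^sub>2 Ks x y = form ip\<^sub>1 Ks (?A x) y"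
    if Ks: "\<forall>H\<in>set Ks. subgroup H G" for Ks
  proof -
    have K: "subgroup (Ks ! i) G" if "i < length Ks" for i using Ks that by simp
    interpret h1: hermitian_space scale V ip\<^sub>1 by unfold_locales (rule subspace_V, fact)
    interpret h2: hermitian_space scale V ip\<^sub>2 by unfold_locales (rule subspace_V, fact)
    show sub: "f.subspace (fixed_sum Ks)"
      unfolding fixed_sum_def by (intro subspace_dsum_space subspace_fixed_space K)
    have card: "card (Ks ! i) > 0" if "i < length Ks" for i
      using subgroup.finite_imp_card_positive[OF K[OF that] finite_carrier] .
    show form1: "hermitian_inner_product (fun_scale scale) (fixed_sum Ks) (form ip\<^sub>1 Ks)"
      unfolding form_def fixed_sum_def
      by (intro h1.dsum_hermitian_inner_product subspace_fixed_space K card) (auto simp: fixed_space_def)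
    show "hermitian_inner_product (fun_scale scale) (fixed_sum Ks) (form ip\<^sub>2 Ks)"
      unfolding form_def fixed_sum_def
      by (intro h2.dsum_hermitian_inner_product subspace_fixed_space K card) (auto simp: fixed_space_def)
    show bas: "set (bas Ks) \<subseteq> fixed_sum Ks"
    proof
      fix x assume "x \<in> set (bas Ks)"
      then obtain i v where i: "i < length Ks" and v: "v \<in> set (basis (Ks ! i))" and x: "x = dsum_incl i v"
        by (auto simp: bas_def dsum_basis_def)
      have "0 \<in> fixed_space V act (Ks ! j)" if "j < length Ks" for j
        using subspace_0[OF subspace_fixed_space[OF K[OF that]]] .
      then show "x \<in> fixed_sum Ks"
        using i v x basis(1)[OF K[OF i]] by (auto simp: fixed_sum_def dsum_space_def dsum_incl_def)
    qed
    show "fixed_sum Ks \<subseteq> f.span (set (bas Ks))"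
      unfolding fixed_sum_def bas_def by (intro dsum_space_subset_span basis K)
    interpret d: hermitian_space "fun_scale scale" "fixed_sum Ks" "form ip\<^sub>1 Ks"
      by unfold_locales (rule sub, rule form1)
    \<comment> \<open>Independence of the combined basis is read off from its Gram determinant, a
      product of factors that are nonzero by positivity on each fixed space.\<close>
    have "det (gram_matrix (form ip\<^sub>1 Ks) (bas Ks)) = (\<Prod>H\<leftarrow>Ks. scaled_gram_det ip\<^sub>1 H (basis H))"
      unfolding form_def bas_def using Ks basis_V by (subst prod_scaled_gram_det[OF assms(5)]) auto
    also have "\<dots> \<noteq> 0"
    proof -
      have "scaled_gram_det ip\<^sub>1 H (basis H) \<noteq> 0" if "H \<in> set Ks" for H
      proof -
        have H: "subgroup H G" using Ks that by simp
        show ?thesis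
          using h1.scaled_gram_det_nonzero[OF basis_V[OF H] basis(3)[OF H]]
            subgroup.finite_imp_card_positive[OF H finite_carrier] by blast
      qed
      then show ?thesis by (auto simp: prod_list_zero_iff)
    qed
    finally show "f.list_independent (bas Ks)"
      by (rule d.list_independent_if_det_gram_matrix[OF bas])
    show "form ip\<^sub>2 Ks x y = form ip\<^sub>1 Ks (?A x) y" if "x \<in> fixed_sum Ks" "y \<in> fixed_sum Ks" for x y
      unfolding form_def dsum_form_def
      by (rule sum.cong) (use that in \<open>simp_all add: A_ip fixed_sum_in_V\<close>)
  qed
  have T: "bij_betw ?T (fixed_sum Hs) (fixed_sum Hs')"
    by (rule bij_betw_byWitness[where f' = "transfer Hs Hs' F"])
      (auto simp: transfer_inverse[OF F' F F'F[rule_format]] transfer_inverse[OF F F' FF'[rule_format]]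
        F.transfer_closed F'.transfer_closed)
  have "det (gram_matrix (form ip\<^sub>1 Hs) (bas Hs)) / det (gram_matrix (form ip\<^sub>1 Hs') (bas Hs'))
      = det (gram_matrix (form ip\<^sub>2 Hs) (bas Hs)) / det (gram_matrix (form ip\<^sub>2 Hs') (bas Hs'))"
  proof (rule f.gram_det_ratio_eq[OF dsum(1) dsum(1) dsum(2,3) dsum(2,3) dsum(4-6) dsum(4-6) T])
    show "form ip\<^sub>2 Hs x y = form ip\<^sub>1 Hs (?A x) y" if "x \<in> fixed_sum Hs" "y \<in> fixed_sum Hs" for x y
      using dsum(7)[OF F.subgroups(1) that] .
    show "form ip\<^sub>2 Hs' x y = form ip\<^sub>1 Hs' (?A x) y" if "x \<in> fixed_sum Hs'" "y \<in> fixed_sum Hs'" for x y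
      using dsum(7)[OF F.subgroups(2) that] .
    show "?T (?A x) = ?A (?T x)" if "x \<in> fixed_sum Hs" for x
      by (rule F'.transfer_commute[OF A A_add A_scale A_act that])
  qed (fact F.subgroups transfer_add transfer_scale A_closed)+
  then show ?thesis
    using prod_scaled_gram_det[OF assms(5), of _ basis] prod_scaled_gram_det[OF assms(7), of _ basis]
      F.subgroups basis_V by (simp add: form_def bas_def)
qed

end
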